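(* (a) There is a constant $c$ such that for every $n$ and all binary strings $x,y$ of length at most $n$ there exists a program $t$ that computes a permutation (bijection) of the set of all binary strings, maps $x$ to $y$, and satisfies $\mathrm{C}(t)\le \mathrm{CT}(x|y)+\mathrm{CT}(y|x)+c\log n$ (for $n\ge 2$). (b) This bound cannot be improved significantly: there are constants $c_1,c_2$ such that for all natural numbers $k,n$ with $n>2k$ there exist binary strings $x,y$ of length $n$ with $\mathrm{C}(x)\le k+c_1\log n$ and $\mathrm{C}(y)\le k+c_1\log n$, such that every program computing a bijection of the set of binary strings that maps $x$ to $y$ has complexity at least $2k-c_2$.
   Context: $\mathrm{C}(x|y)$ denotes plain conditional Kolmogorov complexity (length of a shortest program mapping $y$ to $x$ for a fixed optimal programming language; equivalently up to $O(1)$, the minimal complexity of a program mapping $y$ to $x$), and $\mathrm{C}(x)$ the unconditional plain complexity. The total conditional complexity $\mathrm{CT}(x|y)$ is the minimal complexity $\mathrm{C}(p)$ of a program $p$ that terminates on every input and maps $y$ to $x$. The complexity of a program is its plain Kolmogorov complexity.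
   Formalization: The optimal programming language is also assumed to admit computable translation of programs from every other language (else total programs may not exist), and in (b) log n is read as log max(n,2), since for k=0, n=1 the bound would demand C(x)=0. *)

theory Defs
  imports Complex_Main "HOL-Library.Nat_Bijection" "HOL-Library.Extended_Real"
begin

text \<open>Kleene's \<mu>-operator for a partial function: all values before the first zero must be defined.\<close>

definition mu_search :: "(nat \<rightharpoonup> nat) \<rightharpoonup> nat" where
  "mu_search h =
     (if \<exists>m. h m = Some 0 \<and> (\<forall>j<m. h j \<noteq> None) then Some (LEAST m. h m = Some 0) else None)"

text \<open>The unary partial recursive functions.  Functions of several arguments are represented through
  the Cantor pairing \<^const>\<open>prod_encode\<close>; this gives the same class as Kleene's schemes on tuples.
  In \<open>prec\<close> the argument encodes (parameter, recursion argument).\<close>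

inductive partial_recursive :: "(nat \<rightharpoonup> nat) \<Rightarrow> bool" where
  zero: "partial_recursive (\<lambda>_. Some 0)"
| succ: "partial_recursive (\<lambda>n. Some (Suc n))"
| left: "partial_recursive (\<lambda>n. Some (fst (prod_decode n)))"
| right: "partial_recursive (\<lambda>n. Some (snd (prod_decode n)))"
| pair: "partial_recursive f \<Longrightarrow> partial_recursive g \<Longrightarrow>
    partial_recursive (\<lambda>n. Option.bind (f n) (\<lambda>a. Option.bind (g n) (\<lambda>b. Some (prod_encode (a, b)))))"
| comp: "partial_recursive f \<Longrightarrow> partial_recursive g \<Longrightarrow>
    partial_recursive (\<lambda>n. Option.bind (g n) f)"
| prec: "partial_recursive f \<Longrightarrow> partial_recursive g \<Longrightarrow>
    partial_recursive (\<lambda>n. case prod_decode n of (a, k) \<Rightarrow>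
      rec_nat (f a) (\<lambda>m r. Option.bind r (\<lambda>v. g (prod_encode (a, prod_encode (m, v))))) k)"
| mu: "partial_recursive f \<Longrightarrow>
    partial_recursive (\<lambda>n. mu_search (\<lambda>m. f (prod_encode (n, m))))"

text \<open>Binary strings are numbered by bijective base-2 numeration, least significant digit first.\<close>

fun str_code :: "bool list \<Rightarrow> nat" where
  "str_code [] = 0"
| "str_code (b # bs) = 2 * str_code bs + (if b then 2 else 1)"

lemma bij_str_code: "bij str_code"
proof (rule bijI)
  show "inj str_code"
  proof (rule injI)
    fix p q show "str_code p = str_code q \<Longrightarrow> p = q"
    proof (induction p arbitrary: q)
      case Nil
      then show ?case by (cases q) (auto split: if_splits)
    next
      case (Cons b p)
      then obtain d r where q: "q = d # r" by (cases q) (auto split: if_splits)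
      from Cons.prems q have e: "2 * str_code p + (if b then 2 else 1) = 2 * str_code r + (if d then 2 else 1)"
        by simp
      have "b = d" using e by (cases b; cases d; simp; presburger)
      with e Cons.IH q show ?case by simp
    qed
  qed
  have "\<exists>p. str_code p = n" for n
  proof (induction n rule: less_induct)
    case (less n)
    show ?case
    proof (cases "n = 0")
      case True
      then show ?thesis by (intro exI[of _ "[]"]) simp
    next
      case False
      then have "(n - 1) div 2 < n" by presburger
      then obtain p where p: "str_code p = (n - 1) div 2" using less by blast
      have "n = 2 * ((n - 1) div 2) + (if even n then 2 else 1)"
        using False by (cases "even n"; simp; presburger)
      then have "str_code (even n # p) = n" using p by simp
      then show ?thesis by blast
    qed
  qed
  then show "surj str_code" by (metis surjI)
qed

definition computable :: "(bool list \<Rightarrow> bool list) \<Rightarrow> bool" where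
  "computable h \<longleftrightarrow> (\<exists>f. partial_recursive f \<and> (\<forall>p. f (str_code p) = Some (str_code (h p))))"

text \<open>\<open>U p y\<close> is the output, if any, of program \<open>p\<close> on input \<open>y\<close>.\<close>

type_synonym language = "bool list \<Rightarrow> bool list \<Rightarrow> bool list option"

definition programming_language :: "language \<Rightarrow> bool" where
  "programming_language U \<longleftrightarrow> (\<exists>f. partial_recursive f \<and>
     (\<forall>p y. f (prod_encode (str_code p, str_code y)) = map_option str_code (U p y)))"

definition cond_complexity :: "language \<Rightarrow> bool list \<Rightarrow> bool list \<Rightarrow> enat" where
  "cond_complexity U x y = (INF p \<in> {p. U p y = Some x}. enat (length p))"

definition complexity :: "language \<Rightarrow> bool list \<Rightarrow> enat" where
  "complexity U x = cond_complexity U x []"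

definition optimal_language :: "language \<Rightarrow> bool" where
  "optimal_language U \<longleftrightarrow> programming_language U \<and>
     (\<forall>V. programming_language V \<longrightarrow>
       (\<exists>c::nat. \<forall>x y. cond_complexity U x y \<le> cond_complexity V x y + enat c))"

text \<open>Optimality alone only concerns the lengths of programs for single input-output pairs: there are optimal
  languages in which no program is total.  Notions that refer to the behaviour of a program on all
  inputs need programs of any other language to be effectively translatable (Goedel property).\<close>

definition goedel_language :: "language \<Rightarrow> bool" where
  "goedel_language U \<longleftrightarrow> programming_language U \<and>
     (\<forall>V. programming_language V \<longrightarrow> (\<exists>h. computable h \<and> (\<forall>p y. U (h p) y = V p y)))"

definition total_program :: "language \<Rightarrow> bool list \<Rightarrow> bool" where
  "total_program U p \<longleftrightarrow> (\<forall>z. U p z \<noteq> None)"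

definition total_cond_complexity :: "language \<Rightarrow> bool list \<Rightarrow> bool list \<Rightarrow> enat" where
  "total_cond_complexity U x y = (INF p \<in> {p. total_program U p \<and> U p y = Some x}. complexity U p)"

definition computes_permutation :: "language \<Rightarrow> bool list \<Rightarrow> bool" where
  "computes_permutation U t \<longleftrightarrow> (\<exists>f. bij f \<and> (\<forall>z. U t z = Some (f z)))"

end

theory Submission
  imports Defs "HOL-Library.Log_Nat" "HOL-Library.Monad_Syntax"
    "HOL-Combinatorics.Permutations" "HOL-Computational_Algebra.Primes"
begin

text \<open>
  (a) Let \<open>q\<close> and \<open>p\<close> be total programs taking \<open>x\<close> to \<open>y\<close> and \<open>y\<close> to \<open>x\<close>. The pairs
  \<open>(u, q u)\<close> with \<open>p (q u) = u\<close> form a decidable matching that contains \<open>(x, y)\<close>. Restricted to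
  the strings of length at most \<open>n\<close> it splits into finite chains and cycles, and closing up
  every chain extends it to a permutation, which is computable from descriptions of \<open>p\<close> and \<open>q\<close>
  and from \<open>n\<close>.

  (b) Let \<open>Y\<close> be the set of the first \<open>2 * 2 ^ k\<close> strings of length \<open>n\<close>. Enumerate the programs
  of complexity below \<open>2 * k\<close> that are defined on all strings of length \<open>n\<close> and take at most
  \<open>2 * 2 ^ k\<close> of them into \<open>Y\<close>; there are fewer than \<open>4 ^ k\<close>. Given about \<open>k\<close> bits, namely the
  number of these programs up to an error below \<open>2 ^ k\<close>, one can find all but fewer than \<open>2 ^ k\<close>
  of them. By averaging over the \<open>2 ^ n \<ge> 2 * 4 ^ k\<close> strings of length \<open>n\<close>, some \<open>x\<close> is taken
  into \<open>Y\<close> by at most \<open>2 ^ k\<close> of the programs found, hence by fewer than \<open>2 * 2 ^ k\<close> programs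
  altogether, and some \<open>y\<close> in \<open>Y\<close> is missed.
\<close>

section \<open>Total recursive functions and decidable predicates\<close>

abbreviation pfst :: "nat \<Rightarrow> nat" where "pfst n \<equiv> fst (prod_decode n)"
abbreviation psnd :: "nat \<Rightarrow> nat" where "psnd n \<equiv> snd (prod_decode n)"

definition total_recursive :: "(nat \<Rightarrow> nat) \<Rightarrow> bool" where
  "total_recursive f \<longleftrightarrow> partial_recursive (\<lambda>n. Some (f n))"

definition decidable :: "(nat \<Rightarrow> bool) \<Rightarrow> bool" where
  "decidable P \<longleftrightarrow> total_recursive (\<lambda>n. of_bool (P n))"

named_theorems recursive_intros

lemma partial_recursive_Some [recursive_intros]:
  "total_recursive f \<Longrightarrow> partial_recursive (\<lambda>n. Some (f n))"
  by (simp add: total_recursive_def)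

lemma partial_recursive_comp_total:
  "partial_recursive f \<Longrightarrow> total_recursive a \<Longrightarrow> partial_recursive (\<lambda>n. f (a n))"
  using partial_recursive.comp[of f "\<lambda>n. Some (a n)"] by (simp add: total_recursive_def)

lemma total_recursive_comp:
  "total_recursive f \<Longrightarrow> total_recursive a \<Longrightarrow> total_recursive (\<lambda>n. f (a n))"
  using partial_recursive_comp_total[of "\<lambda>n. Some (f n)" a] by (simp add: total_recursive_def)

lemma total_recursive_pfst [recursive_intros]:
  "total_recursive a \<Longrightarrow> total_recursive (\<lambda>n. pfst (a n))"
  using total_recursive_comp[of pfst a] partial_recursive.left by (simp add: total_recursive_def)

lemma total_recursive_psnd [recursive_intros]:
  "total_recursive a \<Longrightarrow> total_recursive (\<lambda>n. psnd (a n))"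
  using total_recursive_comp[of psnd a] partial_recursive.right by (simp add: total_recursive_def)

lemma total_recursive_Suc [recursive_intros]:
  "total_recursive a \<Longrightarrow> total_recursive (\<lambda>n. Suc (a n))"
  using total_recursive_comp[of Suc a] partial_recursive.succ by (simp add: total_recursive_def)

lemma total_recursive_prod_encode [recursive_intros]:
  "total_recursive a \<Longrightarrow> total_recursive b \<Longrightarrow> total_recursive (\<lambda>n. prod_encode (a n, b n))"
  using partial_recursive.pair[of "\<lambda>n. Some (a n)" "\<lambda>n. Some (b n)"]
  by (simp add: total_recursive_def)

lemma total_recursive_id [recursive_intros]: "total_recursive (\<lambda>n. n)"
  using partial_recursive.pair[OF partial_recursive.left partial_recursive.right]
  by (simp add: total_recursive_def)

lemma total_recursive_const [recursive_intros]: "total_recursive (\<lambda>n. c)"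
  by (induction c)
     (simp_all add: total_recursive_Suc, simp add: total_recursive_def partial_recursive.zero)

lemma partial_recursive_bind [recursive_intros]:
  assumes "partial_recursive f" "partial_recursive (\<lambda>e. g (pfst e) (psnd e))"
  shows "partial_recursive (\<lambda>n. Option.bind (f n) (g n))"
proof -
  have "partial_recursive (\<lambda>n. Option.bind (f n) (\<lambda>v. Some (prod_encode (n, v))))"
    using partial_recursive.pair[OF partial_recursive_Some[OF total_recursive_id] assms(1)] by simp
  from partial_recursive.comp[OF assms(2) this] show ?thesis
    by (simp add: Option.bind_assoc)
qed

lemma partial_recursive_rec_nat:
  assumes "partial_recursive a"
    and "partial_recursive (\<lambda>e. g (pfst e) (pfst (psnd e)) (psnd (psnd e)))"
    and "total_recursive b"
  shows "partial_recursive (\<lambda>n. rec_nat (a n) (\<lambda>m r. Option.bind r (g n m)) (b n))"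
  using partial_recursive_comp_total[OF partial_recursive.prec[OF assms(1,2)]
      total_recursive_prod_encode[OF total_recursive_id assms(3)]]
  by simp

lemma total_recursive_rec_nat:
  assumes "total_recursive a"
    and "total_recursive (\<lambda>e. g (pfst e) (pfst (psnd e)) (psnd (psnd e)))"
    and "total_recursive b"
  shows "total_recursive (\<lambda>n. rec_nat (a n) (g n) (b n))"
proof -
  have "rec_nat (Some x) (\<lambda>m r. Option.bind r (\<lambda>v. Some (g n m v))) k = Some (rec_nat x (g n) k)"
    for x n k by (induction k) auto
  with partial_recursive_rec_nat[OF partial_recursive_Some partial_recursive_Some, OF assms]
  show ?thesis by (simp add: total_recursive_def)
qed

lemma total_recursive_add [recursive_intros]:
  assumes "total_recursive a" "total_recursive b"
  shows "total_recursive (\<lambda>n. a n + b n)"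
proof -
  have "rec_nat x (\<lambda>_. Suc) k = x + k" for x k by (induction k) auto
  moreover have "total_recursive (\<lambda>n. rec_nat (a n) (\<lambda>_. Suc) (b n))"
    by (intro total_recursive_rec_nat recursive_intros assms)
  ultimately show ?thesis by simp
qed

lemma total_recursive_mult [recursive_intros]:
  assumes "total_recursive a" "total_recursive b"
  shows "total_recursive (\<lambda>n. a n * b n)"
proof -
  have "rec_nat 0 (\<lambda>_ r. r + x) k = x * k" for x k :: nat by (induction k) auto
  moreover have "total_recursive (\<lambda>n. rec_nat 0 (\<lambda>_ r. r + a n) (b n))"
    by (intro total_recursive_rec_nat recursive_intros total_recursive_comp[OF assms(1)] assms)
  ultimately show ?thesis by simp
qed

lemma total_recursive_power [recursive_intros]:
  assumes "total_recursive a" "total_recursive b"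
  shows "total_recursive (\<lambda>n. a n ^ b n)"
proof -
  have "rec_nat 1 (\<lambda>_ r. r * x) k = x ^ k" for x k :: nat by (induction k) auto
  moreover have "total_recursive (\<lambda>n. rec_nat 1 (\<lambda>_ r. r * a n) (b n))"
    by (intro total_recursive_rec_nat recursive_intros total_recursive_comp[OF assms(1)] assms)
  ultimately show ?thesis by simp
qed

lemma total_recursive_pred:
  assumes "total_recursive a"
  shows "total_recursive (\<lambda>n. a n - 1)"
proof -
  have "rec_nat 0 (\<lambda>m _. m) k = k - 1" for k by (cases k) auto
  moreover have "total_recursive (\<lambda>n. rec_nat 0 (\<lambda>m _. m) (a n))"
    by (intro total_recursive_rec_nat recursive_intros assms)
  ultimately show ?thesis by simp
qed

lemma total_recursive_diff [recursive_intros]: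
  assumes "total_recursive a" "total_recursive b"
  shows "total_recursive (\<lambda>n. a n - b n)"
proof -
  have "rec_nat x (\<lambda>_ r. r - 1) k = x - k" for x k :: nat by (induction k) auto
  moreover have "total_recursive (\<lambda>n. rec_nat (a n) (\<lambda>_ r. r - 1) (b n))"
    by (intro total_recursive_rec_nat total_recursive_pred recursive_intros assms)
  ultimately show ?thesis by simp
qed

lemma total_recursive_of_bool [recursive_intros]:
  "decidable P \<Longrightarrow> total_recursive (\<lambda>n. of_bool (P n))"
  by (simp add: decidable_def)

lemma total_recursive_if [recursive_intros]:
  assumes "decidable P" "total_recursive a" "total_recursive b"
  shows "total_recursive (\<lambda>n. if P n then a n else b n)"
proof -
  have "rec_nat (b n) (\<lambda>_ _. a n) (of_bool (P n)) = (if P n then a n else b n)" for n by simp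
  moreover have "total_recursive (\<lambda>n. rec_nat (b n) (\<lambda>_ _. a n) (of_bool (P n)))"
    by (intro total_recursive_rec_nat recursive_intros total_recursive_comp[OF assms(2)] assms)
  ultimately show ?thesis by simp
qed

lemma decidable_not [recursive_intros]:
  assumes "decidable P"
  shows "decidable (\<lambda>n. \<not> P n)"
proof -
  have "(if P n then 0 else 1) = (of_bool (\<not> P n) :: nat)" for n by simp
  moreover have "total_recursive (\<lambda>n. if P n then 0 else 1)"
    by (intro recursive_intros assms)
  ultimately show ?thesis by (simp only: decidable_def)
qed

lemma decidable_conj [recursive_intros]:
  "decidable P \<Longrightarrow> decidable Q \<Longrightarrow> decidable (\<lambda>n. P n \<and> Q n)"
  unfolding decidable_def of_bool_conj by (rule total_recursive_mult)

lemma decidable_le [recursive_intros]: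
  assumes "total_recursive a" "total_recursive b"
  shows "decidable (\<lambda>n. a n \<le> b n)"
proof -
  have "1 - (x - y) = of_bool (x \<le> y)" for x y :: nat by auto
  then show ?thesis
    using total_recursive_diff[OF total_recursive_const[of 1] total_recursive_diff[OF assms]]
    by (simp add: decidable_def)
qed

lemma decidable_less [recursive_intros]:
  "total_recursive a \<Longrightarrow> total_recursive b \<Longrightarrow> decidable (\<lambda>n. a n < b n)"
  unfolding Suc_le_eq[symmetric] by (intro decidable_le total_recursive_Suc)

lemma decidable_eq [recursive_intros]:
  "total_recursive a \<Longrightarrow> total_recursive b \<Longrightarrow> decidable (\<lambda>n. a n = b n)"
  unfolding order_eq_iff by (intro decidable_conj decidable_le)

lemma total_recursive_card [recursive_intros]:
  assumes "decidable (\<lambda>e. P (pfst e) (psnd e))" "total_recursive b"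
  shows "total_recursive (\<lambda>n. card {i. i < b n \<and> P n i})"
proof -
  have "rec_nat 0 (\<lambda>i r. if P n i then Suc r else r) k = card {i. i < k \<and> P n i}" for n k
  proof (induction k)
    case (Suc k)
    have "{i. i < Suc k \<and> P n i} = (if P n k then insert k else id) {i. i < k \<and> P n i}"
      by (auto simp: less_Suc_eq)
    with Suc show ?case by simp
  qed simp
  moreover have "decidable (\<lambda>e. P (pfst e) (pfst (psnd e)))"
    using total_recursive_comp[OF total_recursive_of_bool[OF assms(1)],
        of "\<lambda>e. prod_encode (pfst e, pfst (psnd e))"]
    by (simp add: decidable_def recursive_intros)
  then have "total_recursive (\<lambda>n. rec_nat 0 (\<lambda>i r. if P n i then Suc r else r) (b n))"
    by (intro total_recursive_rec_nat recursive_intros assms)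
  ultimately show ?thesis by simp
qed

lemma decidable_all_less [recursive_intros]:
  assumes "decidable (\<lambda>e. P (pfst e) (psnd e))" "total_recursive b"
  shows "decidable (\<lambda>n. \<forall>i<b n. P n i)"
proof -
  have "decidable (\<lambda>n. card {i. i < b n \<and> \<not> P n i} = 0)"
    by (intro recursive_intros assms)
  then show ?thesis by simp
qed

lemma total_recursive_div [recursive_intros]:
  assumes "total_recursive a" "total_recursive b"
  shows "total_recursive (\<lambda>n. a n div b n)"
proof -
  have "{i. i < x \<and> y \<noteq> 0 \<and> Suc i * y \<le> x} = {..<x div y}" for x y :: nat
  proof (cases "y = 0")
    case False
    then have "Suc i * y \<le> x \<longleftrightarrow> i < x div y" for i
      by (simp only: less_eq_div_iff_mult_less_eq Suc_le_eq[symmetric] neq0_conv)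
    moreover have "i < x" if "i < x div y" for i
      using that div_le_dividend[of x y] by linarith
    ultimately show ?thesis using False by auto
  qed simp
  then have "card {i. i < a n \<and> b n \<noteq> 0 \<and> Suc i * b n \<le> a n} = a n div b n" for n
    by simp
  moreover have "total_recursive (\<lambda>n. card {i. i < a n \<and> b n \<noteq> 0 \<and> Suc i * b n \<le> a n})"
    by (intro recursive_intros assms assms[THEN total_recursive_comp])
  ultimately show ?thesis by simp
qed

lemma total_recursive_mod [recursive_intros]:
  assumes "total_recursive a" "total_recursive b"
  shows "total_recursive (\<lambda>n. a n mod b n)"
  unfolding minus_mult_div_eq_mod[symmetric] by (intro recursive_intros assms)

definition least_option :: "(nat \<Rightarrow> bool) \<Rightarrow> nat option" where
  "least_option P = (if \<exists>m. P m then Some (LEAST m. P m) else None)"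

lemma partial_recursive_least_option [recursive_intros]:
  assumes "decidable (\<lambda>e. P (pfst e) (psnd e))"
  shows "partial_recursive (\<lambda>n. least_option (P n))"
proof -
  have "mu_search (\<lambda>m. Some (of_bool (\<not> Q m))) = least_option Q" for Q
    by (simp add: mu_search_def least_option_def)
  moreover have "partial_recursive (\<lambda>e. Some (of_bool (\<not> P (pfst e) (psnd e))))"
    by (intro recursive_intros assms)
  from partial_recursive.mu[OF this]
  have "partial_recursive (\<lambda>n. mu_search (\<lambda>m. Some (of_bool (\<not> P n m))))"
    by simp
  ultimately show ?thesis by simp
qed

lemma total_recursive_Least:
  assumes "decidable (\<lambda>e. P (pfst e) (psnd e))" "\<And>n. \<exists>m. P n m"
  shows "total_recursive (\<lambda>n. LEAST m. P n m)"
  using partial_recursive_least_option[of P] assms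
  by (simp add: total_recursive_def least_option_def)

section \<open>Stagewise approximation of partial recursive functions\<close>

lemma mu_search_eq_Some_iff:
  "mu_search h = Some m \<longleftrightarrow> h m = Some 0 \<and> (\<forall>j<m. \<exists>v. h j = Some (Suc v))"
proof
  assume *: "mu_search h = Some m"
  then obtain l where l: "h l = Some 0" "\<forall>j<l. h j \<noteq> None" and m: "m = (LEAST m. h m = Some 0)"
    by (auto simp: mu_search_def split: if_splits)
  have "h m = Some 0" "m \<le> l" using l m by (auto intro: LeastI Least_le)
  moreover have "h j \<noteq> Some 0" if "j < m" for j using that m not_less_Least by blast
  ultimately show "h m = Some 0 \<and> (\<forall>j<m. \<exists>v. h j = Some (Suc v))"
    using l(2) by (metis less_le_trans not0_implies_Suc option.exhaust)
next
  assume *: "h m = Some 0 \<and> (\<forall>j<m. \<exists>v. h j = Some (Suc v))"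
  then have "(LEAST m. h m = Some 0) = m"
    by (intro Least_equality) (auto simp: not_less[symmetric])
  with * show "mu_search h = Some m" by (fastforce simp: mu_search_def)
qed

definition option_code :: "nat option \<Rightarrow> nat" where
  "option_code = case_option 0 Suc"

lemma option_code_simps [simp]: "option_code None = 0" "option_code (Some v) = Suc v"
  by (simp_all add: option_code_def)

lemma option_code_bind:
  "option_code (Option.bind x f) =
    (if option_code x = 0 then 0 else option_code (f (option_code x - 1)))"
  by (cases x) auto

lemma option_code_eq_1_iff: "option_code x = 1 \<longleftrightarrow> x = Some 0"
  by (cases x) auto

lemma option_code_gt_1_iff: "1 < option_code x \<longleftrightarrow> (\<exists>v. x = Some (Suc v))"
  by (cases x) (auto simp: gr0_conv_Suc)

lemma option_code_mu_search:
  assumes "\<exists>m. option_code (h m) \<le> 1"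
  defines "stop \<equiv> LEAST m. option_code (h m) \<le> 1"
  shows "option_code (mu_search h) = (if option_code (h stop) = 1 then Suc stop else 0)"
proof -
  have at_stop: "option_code (h stop) \<le> 1"
    unfolding stop_def by (rule LeastI_ex[OF assms(1)])
  have before: "1 < option_code (h j)" if "j < stop" for j
    using not_less_Least[of j "\<lambda>m. option_code (h m) \<le> 1"] that by (simp add: stop_def)
  have iff: "mu_search h = Some m \<longleftrightarrow> option_code (h m) = 1 \<and> (\<forall>j<m. 1 < option_code (h j))" for m
    by (simp only: mu_search_eq_Some_iff option_code_eq_1_iff option_code_gt_1_iff)
  show ?thesis
  proof (cases "mu_search h")
    case None
    then show ?thesis using iff[of stop] before by auto
  next
    case (Some m)
    then have "m = stop"
      using iff[of m] at_stop before by (metis linorder_neqE_nat not_less order_refl)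
    then show ?thesis using Some iff[of m] by simp
  qed
qed

definition approximates :: "(nat \<Rightarrow> nat \<rightharpoonup> nat) \<Rightarrow> (nat \<rightharpoonup> nat) \<Rightarrow> bool" where
  "approximates g f \<longleftrightarrow> total_recursive (\<lambda>e. option_code (g (pfst e) (psnd e))) \<and>
     (\<forall>s t. s \<le> t \<longrightarrow> g s \<subseteq>\<^sub>m g t) \<and>
     (\<forall>s. g s \<subseteq>\<^sub>m f) \<and>
     (\<forall>n\<in>dom f. \<forall>\<^sub>F s in sequentially. g s n = f n)"

lemma map_le_iff_Some: "h \<subseteq>\<^sub>m h' \<longleftrightarrow> (\<forall>n v. h n = Some v \<longrightarrow> h' n = Some v)"
  by (auto simp: map_le_def dom_def)

lemma total_recursive_approximation:
  assumes "approximates g f" "total_recursive a" "total_recursive b"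
  shows "total_recursive (\<lambda>n. option_code (g (a n) (b n)))"
  using assms total_recursive_comp[of "\<lambda>e. option_code (g (pfst e) (psnd e))",
      OF _ total_recursive_prod_encode[of a b]]
  by (simp add: approximates_def)

lemma approximates_mono: "approximates g f \<Longrightarrow> s \<le> t \<Longrightarrow> g s \<subseteq>\<^sub>m g t"
  and approximates_map_le: "approximates g f \<Longrightarrow> g s \<subseteq>\<^sub>m f"
  and approximates_eventually:
    "approximates g f \<Longrightarrow> f n = Some v \<Longrightarrow> \<forall>\<^sub>F s in sequentially. g s n = Some v"
  by (auto simp: approximates_def dom_def)

lemma approximates_Some:
  "total_recursive f \<Longrightarrow> approximates (\<lambda>_ n. Some (f n)) (\<lambda>n. Some (f n))"
  by (simp add: approximates_def recursive_intros total_recursive_comp[of f])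

lemma approximates_comp_total:
  assumes "approximates g f" "total_recursive a"
  shows "approximates (\<lambda>s n. g s (a n)) (\<lambda>n. f (a n))"
  using assms
  by (auto simp: approximates_def map_le_iff_Some dom_def
      intro!: total_recursive_approximation[OF assms(1)] total_recursive_comp[OF assms(2)]
        recursive_intros)

lemma map_le_bind:
  assumes "f \<subseteq>\<^sub>m f'" "\<And>n. g n \<subseteq>\<^sub>m g' n"
  shows "(\<lambda>n. Option.bind (f n) (g n)) \<subseteq>\<^sub>m (\<lambda>n. Option.bind (f' n) (g' n))"
  using assms by (auto simp: map_le_iff_Some bind_eq_Some_conv)

lemma map_le_uncurryD:
  assumes "(\<lambda>e. g (pfst e) (psnd e)) \<subseteq>\<^sub>m (\<lambda>e. g' (pfst e) (psnd e))"
  shows "g n \<subseteq>\<^sub>m g' n"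
  using assms unfolding map_le_iff_Some by (metis fst_conv prod_encode_inverse snd_conv)

lemma approximates_bind:
  assumes F: "approximates F f"
    and G: "approximates (\<lambda>s e. G s (pfst e) (psnd e)) (\<lambda>e. g (pfst e) (psnd e))"
  shows "approximates (\<lambda>s n. Option.bind (F s n) (G s n)) (\<lambda>n. Option.bind (f n) (g n))"
  unfolding approximates_def
proof (intro conjI allI impI ballI)
  have G_rec: "total_recursive (\<lambda>n. option_code (G (a n) (b n) (c n)))"
    if "total_recursive a" "total_recursive b" "total_recursive c" for a b c
    using total_recursive_approximation[OF G that(1) total_recursive_prod_encode[OF that(2,3)]]
    by simp
  show "total_recursive (\<lambda>e. option_code (Option.bind (F (pfst e) (psnd e)) (G (pfst e) (psnd e))))"
    unfolding option_code_bind by (intro recursive_intros total_recursive_approximation[OF F] G_rec)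
next
  show "(\<lambda>n. Option.bind (F s n) (G s n)) \<subseteq>\<^sub>m (\<lambda>n. Option.bind (F t n) (G t n))" if "s \<le> t" for s t
    by (intro map_le_bind approximates_mono[OF F that]
        map_le_uncurryD[OF approximates_mono[OF G that]])
next
  show "(\<lambda>n. Option.bind (F s n) (G s n)) \<subseteq>\<^sub>m (\<lambda>n. Option.bind (f n) (g n))" for s
    by (intro map_le_bind approximates_map_le[OF F] map_le_uncurryD[OF approximates_map_le[OF G]])
next
  fix n
  assume "n \<in> dom (\<lambda>n. Option.bind (f n) (g n))"
  then obtain u v where "f n = Some u" "g n u = Some v"
    by (auto simp: bind_eq_Some_conv)
  with approximates_eventually[OF F, of n u]
    approximates_eventually[OF G, of "prod_encode (n, u)" v]
  have "\<forall>\<^sub>F s in sequentially. F s n = Some u" "\<forall>\<^sub>F s in sequentially. G s n u = Some v"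
    by simp_all
  then show "\<forall>\<^sub>F s in sequentially. Option.bind (F s n) (G s n) = Option.bind (f n) (g n)"
    by eventually_elim (simp add: \<open>f n = Some u\<close> \<open>g n u = Some v\<close>)
qed

definition primitive_recursion :: "(nat \<rightharpoonup> nat) \<Rightarrow> (nat \<rightharpoonup> nat) \<Rightarrow> nat \<Rightarrow> nat \<Rightarrow> nat option" where
  "primitive_recursion f g a k =
     rec_nat (f a) (\<lambda>m r. Option.bind r (\<lambda>v. g (prod_encode (a, prod_encode (m, v))))) k"

lemma primitive_recursion_simps [simp]:
  "primitive_recursion f g a 0 = f a"
  "primitive_recursion f g a (Suc k) =
     Option.bind (primitive_recursion f g a k) (\<lambda>v. g (prod_encode (a, prod_encode (k, v))))"
  by (simp_all add: primitive_recursion_def)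

lemma primitive_recursion_map_le:
  assumes "f \<subseteq>\<^sub>m f'" "g \<subseteq>\<^sub>m g'"
  shows "(\<lambda>n. primitive_recursion f g (a n) (b n)) \<subseteq>\<^sub>m (\<lambda>n. primitive_recursion f' g' (a n) (b n))"
proof -
  have "primitive_recursion f' g' a k = Some v" if "primitive_recursion f g a k = Some v" for a k v
    using that assms by (induction k arbitrary: v) (auto simp: map_le_iff_Some bind_eq_Some_conv)
  then show ?thesis by (simp add: map_le_iff_Some)
qed

lemma approximates_primitive_recursion:
  assumes F: "approximates F f" and G: "approximates G g"
  shows "approximates (\<lambda>s n. primitive_recursion (F s) (G s) (pfst n) (psnd n))
    (\<lambda>n. primitive_recursion f g (pfst n) (psnd n))"
  unfolding approximates_def
proof (intro conjI allI impI ballI)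
  have "option_code (primitive_recursion (F s) (G s) a k) = rec_nat (option_code (F s a))
      (\<lambda>m r. if r = 0 then 0 else option_code (G s (prod_encode (a, prod_encode (m, r - 1))))) k"
    for s a k
    by (induction k) (simp_all add: option_code_bind)
  then show "total_recursive (\<lambda>e. option_code
      (primitive_recursion (F (pfst e)) (G (pfst e)) (pfst (psnd e)) (psnd (psnd e))))"
    by (simp only:) (intro total_recursive_rec_nat recursive_intros
        total_recursive_approximation[OF F] total_recursive_approximation[OF G])
next
  fix n
  have "\<forall>\<^sub>F s in sequentially. primitive_recursion (F s) (G s) a k = Some v"
    if "primitive_recursion f g a k = Some v" for a k v
    using that
  proof (induction k arbitrary: v)
    case 0
    then show ?case using approximates_eventually[OF F] by simp
  next
    case (Suc k)
    then obtain u where u: "primitive_recursion f g a k = Some u"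
      "g (prod_encode (a, prod_encode (k, u))) = Some v"
      by (auto simp: bind_eq_Some_conv)
    from Suc.IH[OF u(1)] approximates_eventually[OF G u(2)] show ?case
      by eventually_elim simp
  qed
  moreover assume "n \<in> dom (\<lambda>n. primitive_recursion f g (pfst n) (psnd n))"
  ultimately show "\<forall>\<^sub>F s in sequentially.
      primitive_recursion (F s) (G s) (pfst n) (psnd n) = primitive_recursion f g (pfst n) (psnd n)"
    by auto
qed (intro primitive_recursion_map_le approximates_mono[OF F] approximates_mono[OF G]
    approximates_map_le[OF F] approximates_map_le[OF G]; assumption)+

definition bounded_mu_search :: "nat \<Rightarrow> (nat \<rightharpoonup> nat) \<rightharpoonup> nat" where
  "bounded_mu_search s h = mu_search (\<lambda>m. if m < s then h m else None)"

lemma bounded_mu_search_eq_Some_iff: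
  "bounded_mu_search s h = Some m \<longleftrightarrow> m < s \<and> mu_search h = Some m"
  unfolding bounded_mu_search_def mu_search_eq_Some_iff by (cases "m < s") auto

lemma mu_search_map_le:
  assumes "h \<subseteq>\<^sub>m h'" "mu_search h = Some m"
  shows "mu_search h' = Some m"
  using assms unfolding mu_search_eq_Some_iff map_le_iff_Some by blast

lemma total_recursive_bounded_mu_search:
  assumes "total_recursive (\<lambda>e. option_code (h (pfst e) (psnd e)))" "total_recursive b"
  shows "total_recursive (\<lambda>n. option_code (bounded_mu_search (b n) (h n)))"
proof -
  define code where "code n m = (if m < b n then option_code (h n m) else 0)" for n m
  define stop where "stop n = (LEAST m. code n m \<le> 1)" for n
  have h_rec: "total_recursive (\<lambda>n. option_code (h (a n) (a' n)))"
    if "total_recursive a" "total_recursive a'" for a a'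
    using total_recursive_comp[OF assms(1) total_recursive_prod_encode[OF that]] by simp
  have code_rec: "total_recursive (\<lambda>n. code (a n) (a' n))"
    if "total_recursive a" "total_recursive a'" for a a'
    unfolding code_def by (intro recursive_intros h_rec that total_recursive_comp[OF assms(2)])
  have code: "option_code (if m < b n then h n m else None) = code n m" for n m
    by (simp add: code_def)
  have ex_stop: "\<exists>m. code n m \<le> 1" for n
    by (rule exI[of _ "b n"]) (simp add: code_def)
  have "option_code (bounded_mu_search (b n) (h n)) =
      (if code n (stop n) = 1 then Suc (stop n) else 0)" for n
    using option_code_mu_search[of "\<lambda>m. if m < b n then h n m else None"] ex_stop[of n]
    unfolding bounded_mu_search_def code stop_def by blast
  moreover have "total_recursive stop"
    unfolding stop_def by (intro total_recursive_Least recursive_intros code_rec ex_stop)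
  then have "total_recursive (\<lambda>n. if code n (stop n) = 1 then Suc (stop n) else 0)"
    by (intro recursive_intros code_rec)
  ultimately show ?thesis by simp
qed

lemma approximates_mu_search:
  assumes F: "approximates F f"
  shows "approximates (\<lambda>s n. bounded_mu_search s (\<lambda>m. F s (prod_encode (n, m))))
    (\<lambda>n. mu_search (\<lambda>m. f (prod_encode (n, m))))"
  unfolding approximates_def
proof (intro conjI allI impI ballI)
  show "total_recursive
      (\<lambda>e. option_code (bounded_mu_search (pfst e) (\<lambda>m. F (pfst e) (prod_encode (psnd e, m)))))"
    by (intro total_recursive_bounded_mu_search total_recursive_approximation[OF F]
        recursive_intros)
next
  show "(\<lambda>n. bounded_mu_search s (\<lambda>m. F s (prod_encode (n, m))))
      \<subseteq>\<^sub>m (\<lambda>n. bounded_mu_search t (\<lambda>m. F t (prod_encode (n, m))))" if "s \<le> t" for s t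
    using that approximates_mono[OF F that]
    by (auto simp: map_le_iff_Some bounded_mu_search_eq_Some_iff elim!: mu_search_map_le[rotated])
next
  show "(\<lambda>n. bounded_mu_search s (\<lambda>m. F s (prod_encode (n, m))))
      \<subseteq>\<^sub>m (\<lambda>n. mu_search (\<lambda>m. f (prod_encode (n, m))))" for s
    using approximates_map_le[OF F, of s]
    by (auto simp: map_le_iff_Some bounded_mu_search_eq_Some_iff elim!: mu_search_map_le[rotated])
next
  fix n
  assume "n \<in> dom (\<lambda>n. mu_search (\<lambda>m. f (prod_encode (n, m))))"
  then obtain m where m: "mu_search (\<lambda>m. f (prod_encode (n, m))) = Some m" by blast
  have "\<forall>\<^sub>F s in sequentially. \<forall>j\<in>{..m}. F s (prod_encode (n, j)) = f (prod_encode (n, j))"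
  proof (intro eventually_ball_finite ballI)
    fix j assume "j \<in> {..m}"
    then have "f (prod_encode (n, j)) \<noteq> None" using m by (auto simp: mu_search_eq_Some_iff le_less)
    then show "\<forall>\<^sub>F s in sequentially. F s (prod_encode (n, j)) = f (prod_encode (n, j))"
      using approximates_eventually[OF F] by auto
  qed simp
  with eventually_gt_at_top[of m]
  have "\<forall>\<^sub>F s in sequentially. bounded_mu_search s (\<lambda>m. F s (prod_encode (n, m))) = Some m"
    by eventually_elim (use m in \<open>simp add: bounded_mu_search_eq_Some_iff mu_search_eq_Some_iff\<close>)
  then show "\<forall>\<^sub>F s in sequentially. bounded_mu_search s (\<lambda>m. F s (prod_encode (n, m)))
      = mu_search (\<lambda>m. f (prod_encode (n, m)))"
    by (simp add: m)
qed

theorem partial_recursive_approximates: "partial_recursive f \<Longrightarrow> \<exists>g. approximates g f"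
proof (induction rule: partial_recursive.induct)
  case (pair f g)
  then obtain F G where F: "approximates F f" and G: "approximates G g" by blast
  show ?case
    by (rule exI, rule approximates_bind[OF F], rule approximates_bind,
        rule approximates_comp_total[OF G], intro recursive_intros,
        rule approximates_Some, intro recursive_intros)
next
  case (comp f g)
  then obtain F G where F: "approximates F f" and G: "approximates G g" by blast
  show ?case
    by (rule exI, rule approximates_bind[OF G], rule approximates_comp_total[OF F],
        intro recursive_intros)
next
  case (prec f g)
  then show ?case
    using approximates_primitive_recursion
    by (fastforce simp: case_prod_beta primitive_recursion_def)
next
  case (mu f)
  then show ?case using approximates_mu_search by blast
qed (rule exI, rule approximates_Some, intro recursive_intros)+

section \<open>Programs, strings and complexity in terms of codes\<close>

abbreviation str_decode :: "nat \<Rightarrow> bool list" where "str_decode \<equiv> inv str_code"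

lemma str_decode_code [simp]: "str_decode (str_code p) = p"
  and str_code_decode [simp]: "str_code (str_decode m) = m"
  using bij_str_code by (simp_all add: bij_is_inj bij_is_surj surj_f_inv_f)

lemma length_less_iff_str_code: "length p < n \<longleftrightarrow> Suc (str_code p) < 2 ^ n"
proof (induction p arbitrary: n)
  case Nil
  show ?case using one_less_power[of "2::nat" n] by (cases "n = 0") simp_all
next
  case (Cons b p)
  show ?case
  proof (cases n)
    case (Suc m)
    have "length (b # p) < n \<longleftrightarrow> Suc (str_code p) < 2 ^ m" using Cons Suc by simp
    also have "\<dots> \<longleftrightarrow> Suc (str_code (b # p)) < 2 ^ n" unfolding Suc by (cases b) (simp; arith)+
    finally show ?thesis .
  qed simp
qed

definition string_codes :: "nat \<Rightarrow> nat set" where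
  "string_codes n = {2 ^ n - 1..<2 ^ Suc n - 1}"

lemma string_codes_iff: "str_code p \<in> string_codes n \<longleftrightarrow> length p = n"
proof -
  have "length p = n \<longleftrightarrow> \<not> length p < n \<and> length p < Suc n" by linarith
  also have "\<dots> \<longleftrightarrow> str_code p \<in> string_codes n"
    unfolding length_less_iff_str_code string_codes_def by auto
  finally show ?thesis by simp
qed

lemma finite_string_codes: "finite (string_codes n)"
  and card_string_codes: "card (string_codes n) = 2 ^ n"
  by (simp_all add: string_codes_def)

definition run_code :: "language \<Rightarrow> nat \<Rightarrow> nat \<Rightarrow> nat option" where
  "run_code U p y = map_option str_code (U (str_decode p) (str_decode y))"

lemma run_code_eq_Some_iff:
  "run_code U p y = Some x \<longleftrightarrow> U (str_decode p) (str_decode y) = Some (str_decode x)"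
  by (auto simp: run_code_def)

lemma programming_language_iff:
  "programming_language U \<longleftrightarrow> partial_recursive (\<lambda>e. run_code U (pfst e) (psnd e))"
proof
  assume "programming_language U"
  then obtain f where "partial_recursive f"
    and f: "\<And>p y. f (prod_encode (str_code p, str_code y)) = map_option str_code (U p y)"
    unfolding programming_language_def by blast
  have "f e = run_code U (pfst e) (psnd e)" for e
    using f[of "str_decode (pfst e)" "str_decode (psnd e)"] by (simp add: run_code_def)
  then have "f = (\<lambda>e. run_code U (pfst e) (psnd e))" by blast
  with \<open>partial_recursive f\<close> show "partial_recursive (\<lambda>e. run_code U (pfst e) (psnd e))" by simp
next
  assume "partial_recursive (\<lambda>e. run_code U (pfst e) (psnd e))"
  then show "programming_language U"
    unfolding programming_language_def
    by (intro exI[of _ "\<lambda>e. run_code U (pfst e) (psnd e)"]) (simp add: run_code_def)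
qed

lemma partial_recursive_run_code [recursive_intros]:
  assumes "programming_language U" "total_recursive a" "total_recursive b"
  shows "partial_recursive (\<lambda>n. run_code U (a n) (b n))"
  using partial_recursive_comp_total[OF assms(1)[unfolded programming_language_iff]
      total_recursive_prod_encode[OF assms(2,3)]]
  by simp

definition language_of :: "(nat \<rightharpoonup> nat) \<Rightarrow> language" where
  "language_of f p y = map_option str_decode (f (prod_encode (str_code p, str_code y)))"

lemma run_code_language_of: "run_code (language_of f) p y = f (prod_encode (p, y))"
  by (simp add: run_code_def language_of_def option.map_comp o_def option.map_ident)

lemma programming_language_language_of: "partial_recursive f \<Longrightarrow> programming_language (language_of f)"
  by (simp add: programming_language_iff run_code_language_of)

theorem goedel_language_smn:
  assumes "goedel_language U" "partial_recursive f"
  shows "\<exists>h. total_recursive h \<and> (\<forall>p y. run_code U (h p) y = f (prod_encode (p, y)))"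
proof -
  obtain h where "computable h" and h: "\<And>p y. U (h p) y = language_of f p y"
    using assms programming_language_language_of unfolding goedel_language_def by metis
  then obtain g where "partial_recursive g" "\<And>p. g (str_code p) = Some (str_code (h p))"
    unfolding computable_def by blast
  moreover from this(2) have "g = (\<lambda>p. Some (str_code (h (str_decode p))))"
    by (metis str_code_decode)
  ultimately have "total_recursive (\<lambda>p. str_code (h (str_decode p)))"
    by (simp add: total_recursive_def)
  moreover have "run_code U (str_code (h (str_decode p))) y = f (prod_encode (p, y))" for p y
    using run_code_language_of[of f p y] by (simp add: run_code_def h)
  ultimately show ?thesis by blast
qed

lemma cond_complexity_less_iff:
  "cond_complexity U x y < enat n \<longleftrightarrow>
    (\<exists>p. Suc p < 2 ^ n \<and> run_code U p (str_code y) = Some (str_code x))"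
proof -
  have "cond_complexity U x y < enat n \<longleftrightarrow> (\<exists>p. length p < n \<and> U p y = Some x)"
    by (auto simp: cond_complexity_def INF_less_iff)
  also have "\<dots> \<longleftrightarrow> (\<exists>p. Suc p < 2 ^ n \<and> U (str_decode p) y = Some x)"
    unfolding length_less_iff_str_code by (metis str_code_decode str_decode_code)
  finally show ?thesis by (simp add: run_code_eq_Some_iff)
qed

lemma complexity_less_iff:
  "complexity U x < enat n \<longleftrightarrow> (\<exists>d. Suc d < 2 ^ n \<and> run_code U d 0 = Some (str_code x))"
  using cond_complexity_less_iff[of U x "[]" n] by (simp add: complexity_def)

lemma total_cond_complexity_less_iff:
  "total_cond_complexity U x y < enat n \<longleftrightarrow> (\<exists>p d. total_program U p \<and> U p y = Some x \<and>
    Suc d < 2 ^ n \<and> run_code U d 0 = Some (str_code p))"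
  by (auto simp: total_cond_complexity_def INF_less_iff complexity_less_iff)

lemma optimal_language_complexity_le:
  assumes "optimal_language U" "partial_recursive f"
  shows "\<exists>c. \<forall>d x n. f d = Some x \<longrightarrow> d < 2 ^ n \<longrightarrow> complexity U (str_decode x) \<le> enat (n + c)"
proof -
  define V where "V = language_of (\<lambda>e. f (pfst e))"
  have "programming_language V"
    unfolding V_def
    by (intro programming_language_language_of partial_recursive_comp_total[OF assms(2)]
        recursive_intros)
  then obtain c where c: "\<And>x y. cond_complexity U x y \<le> cond_complexity V x y + enat c"
    using assms(1) unfolding optimal_language_def by blast
  have "complexity U (str_decode x) \<le> enat (n + (1 + c))" if "f d = Some x" "d < 2 ^ n" for d x n
  proof -
    have "run_code V d 0 = Some x"
      using that(1) by (simp add: V_def run_code_language_of)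
    moreover have "Suc d < 2 ^ Suc n" using that(2) by simp
    ultimately have "cond_complexity V (str_decode x) [] < enat (Suc n)"
      unfolding complexity_def[symmetric] complexity_less_iff by (metis str_code_decode)
    then have "cond_complexity V (str_decode x) [] + enat c \<le> enat (Suc n) + enat c"
      by (intro add_right_mono less_imp_le)
    with c[of "str_decode x" "[]"] show ?thesis by (auto simp: complexity_def)
  qed
  then show ?thesis by blast
qed

lemma total_cond_complexity_le_length:
  assumes "optimal_language U" "goedel_language U"
  shows "\<exists>c. \<forall>x y. total_cond_complexity U x y \<le> enat (length x + c)"
proof -
  have "partial_recursive (\<lambda>e. Some (pfst e))" by (intro recursive_intros)
  from goedel_language_smn[OF assms(2) this] obtain h where "total_recursive h"
    and h: "\<And>x y. run_code U (h x) y = Some (pfst (prod_encode (x, y)))"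
    by blast
  from optimal_language_complexity_le[OF assms(1) partial_recursive_Some[OF this(1)]] obtain c
    where c: "\<And>d n. d < 2 ^ n \<Longrightarrow> complexity U (str_decode (h d)) \<le> enat (n + c)"
    by blast
  have "total_cond_complexity U x y \<le> enat (length x + (1 + c))" for x y
  proof -
    define p where "p = str_decode (h (str_code x))"
    have "U p z = Some x" for z
      using h[of "str_code x" "str_code z"] by (simp add: p_def run_code_eq_Some_iff)
    then have "total_cond_complexity U x y \<le> complexity U p"
      unfolding total_cond_complexity_def total_program_def by (intro INF_lower) simp
    also have "str_code x < 2 ^ Suc (length x)"
      using length_less_iff_str_code[of x "Suc (length x)"] by linarith
    then have "complexity U p \<le> enat (Suc (length x) + c)"
      unfolding p_def by (rule c)
    finally show ?thesis by simp
  qed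
  then show ?thesis by blast
qed

section \<open>Descriptions of pairs\<close>

lemma total_recursive_multiplicity [recursive_intros]:
  fixes p :: nat
  assumes "1 < p" "total_recursive a"
  shows "total_recursive (\<lambda>n. multiplicity p (a n))"
proof -
  have "{i. i < m \<and> m mod p ^ Suc i = 0} = {..<multiplicity p m}" if "m \<noteq> 0" for m
  proof -
    have iff: "m mod p ^ Suc i = 0 \<longleftrightarrow> i < multiplicity p m" for i
      using that assms(1) power_dvd_iff_le_multiplicity[of m p "Suc i"]
      by (simp add: mod_eq_0_iff_dvd Suc_le_eq del: power_Suc)
    moreover have "i < m" if "m mod p ^ Suc i = 0" for i
    proof -
      have "p ^ Suc i \<le> m" using that \<open>m \<noteq> 0\<close> by (intro dvd_imp_le) auto
      with power_gt_expt[of p "Suc i"] assms(1) show ?thesis by simp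
    qed
    ultimately show ?thesis by auto
  qed
  then have "card {i. i < m \<and> m mod p ^ Suc i = 0} = multiplicity p m" for m
    by (cases "m = 0") simp_all
  moreover have "total_recursive (\<lambda>n. card {i. i < a n \<and> a n mod p ^ Suc i = 0})"
    by (intro recursive_intros assms total_recursive_comp[OF assms(2)])
  ultimately show ?thesis by simp
qed

text \<open>The width \<open>J\<close> of the first component is recovered as the multiplicity of 2.\<close>

definition pack :: "nat \<Rightarrow> nat \<Rightarrow> nat \<Rightarrow> nat" where
  "pack J m r = 2 ^ J * (1 + 2 * (m + 2 ^ J * r))"

definition unpack :: "nat \<Rightarrow> nat" where
  "unpack w = (let J = multiplicity 2 w; q = w div 2 ^ Suc J
     in prod_encode (q mod 2 ^ J, q div 2 ^ J))"

lemma total_recursive_unpack: "total_recursive unpack"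
  unfolding unpack_def Let_def by (intro recursive_intros) simp_all

lemma unpack_pack:
  assumes "m < 2 ^ J"
  shows "unpack (pack J m r) = prod_encode (m, r)"
proof -
  have "multiplicity 2 (pack J m r) = J"
    by (rule multiplicity_decomposeI[where x' = "1 + 2 * (m + 2 ^ J * r)"]) (simp_all add: pack_def)
  moreover have "pack J m r div 2 ^ Suc J = m + 2 ^ J * r"
    unfolding pack_def power_Suc2 by (subst div_mult_mult1) simp_all
  ultimately show ?thesis using assms by (simp add: unpack_def Let_def)
qed

lemma mixed_radix_less:
  fixes l r M B :: nat
  assumes "l < M" "r < B"
  shows "l + M * r < M * B"
proof -
  have "M * Suc r \<le> M * B" using assms(2) by (intro mult_le_mono2) simp
  with assms(1) show ?thesis by simp
qed

lemma pack_less: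
  assumes "m < 2 ^ J" "r < 2 ^ b"
  shows "pack J m r < 2 ^ (2 * J + b + 1)"
proof -
  have "1 + 2 * (m + 2 ^ J * r) < 2 * (2 ^ J * 2 ^ b)"
    by (intro mixed_radix_less assms) simp
  then have "pack J m r < 2 ^ J * (2 * (2 ^ J * 2 ^ b))"
    unfolding pack_def by (rule mult_strict_left_mono) simp
  also have "\<dots> = 2 ^ (2 * J + b + 1)"
    by (simp flip: power_add power_Suc add: mult_2)
  finally show ?thesis .
qed

theorem complexity_pair_le:
  assumes "optimal_language U" "partial_recursive f"
  shows "\<exists>c. \<forall>m r x J b. f (prod_encode (m, r)) = Some x \<longrightarrow> m < 2 ^ J \<longrightarrow> r < 2 ^ b \<longrightarrow>
    complexity U (str_decode x) \<le> enat (2 * J + b + c)"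
proof -
  have "partial_recursive (\<lambda>w. f (unpack w))"
    by (rule partial_recursive_comp_total[OF assms(2) total_recursive_unpack])
  from optimal_language_complexity_le[OF assms(1) this] obtain c
    where c: "\<And>w x n. f (unpack w) = Some x \<Longrightarrow> w < 2 ^ n \<Longrightarrow>
      complexity U (str_decode x) \<le> enat (n + c)"
    by blast
  have "complexity U (str_decode x) \<le> enat (2 * J + b + (1 + c))"
    if "f (prod_encode (m, r)) = Some x" "m < 2 ^ J" "r < 2 ^ b" for m r x J b
    using c[OF _ pack_less[OF that(2,3)]] that(1) by (simp add: unpack_pack[OF that(2)])
  then show ?thesis by blast
qed

corollary complexity_pair_le_log:
  assumes "optimal_language U" "partial_recursive f"
  shows "\<exists>c. \<forall>m r x N b. f (prod_encode (m, r)) = Some x \<longrightarrow> 2 \<le> N \<longrightarrow> m < N ^ d \<longrightarrow> r < N ^ d * 2 ^ b \<longrightarrow>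
    ereal_of_enat (complexity U (str_decode x)) \<le> ereal (real b + c * log 2 (real N))"
proof -
  obtain c where c: "\<And>m r x J b. f (prod_encode (m, r)) = Some x \<Longrightarrow> m < 2 ^ J \<Longrightarrow> r < 2 ^ b \<Longrightarrow>
      complexity U (str_decode x) \<le> enat (2 * J + b + c)"
    using complexity_pair_le[OF assms] by blast
  have "ereal_of_enat (complexity U (str_decode x))
      \<le> ereal (real b + (3 * real d + 3 + real c) * log 2 (real N))"
    if f: "f (prod_encode (m, r)) = Some x" and N: "2 \<le> N"
      and m: "m < N ^ d" and r: "r < N ^ d * 2 ^ b"
    for m r x N b
  proof -
    define J where "J = ceillog2 (N ^ d)"
    have "N ^ d \<le> 2 ^ J" unfolding J_def by (rule le_two_power_ceillog2)
    then have "m < 2 ^ J" "N ^ d * 2 ^ b \<le> 2 ^ (J + b)"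
      using m by (simp_all add: power_add)
    with c[OF f, of J "J + b"] r have "complexity U (str_decode x) \<le> enat (2 * J + (J + b) + c)"
      by simp
    then have "ereal_of_enat (complexity U (str_decode x))
        \<le> ereal_of_enat (enat (2 * J + (J + b) + c))"
      by (simp only: ereal_of_enat_le_iff)
    also have "\<dots> = ereal (3 * real J + real b + real c)" by simp
    also have "\<dots> \<le> ereal (real b + (3 * real d + 3 + real c) * log 2 (real N))"
    proof -
      have "real J \<le> real d * log 2 (real N) + 1"
        using ceillog2_less_log[of "N ^ d"] N by (simp add: J_def log_nat_power)
      moreover have "0 \<le> (3 + real c) * (log 2 (real N) - 1)"
        using N by (simp add: le_log_iff)
      ultimately show ?thesis by (simp add: algebra_simps)
    qed
    finally show ?thesis .
  qed
  then show ?thesis by blast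
qed

lemma prod_encode_less: "prod_encode (a, b) < (a + b + 1) ^ 2"
proof -
  have "triangle (a + b) \<le> (a + b) * Suc (a + b)"
    unfolding triangle_def by (rule div_le_dividend)
  then show ?thesis by (simp add: prod_encode_def power2_eq_square)
qed

lemma prod_encode_less_power:
  assumes "2 \<le> N" "a \<le> N + c" "b \<le> N"
  shows "prod_encode (a, b) < N ^ (2 * (c + 3))"
proof -
  have "a + b + 1 \<le> N * (c + 3)"
    using assms mult_le_mono1[OF assms(1), of "c + 1"] by (simp add: algebra_simps)
  also have "c + 3 \<le> 2 ^ (c + 2)" by (induction c) auto
  then have "N * (c + 3) \<le> N * 2 ^ (c + 2)" by simp
  also have "\<dots> \<le> N ^ (c + 3)"
    using power_mono[OF assms(1), of "c + 2"] by (simp add: eval_nat_numeral)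
  finally have "(a + b + 1) ^ 2 \<le> (N ^ (c + 3)) ^ 2" by (rule power_mono) simp
  with prod_encode_less[of a b] show ?thesis by (simp add: power_mult[symmetric] mult.commute)
qed

section \<open>Closing a matching to a permutation\<close>

definition step_on :: "'a set \<Rightarrow> ('a \<Rightarrow> 'a) \<Rightarrow> 'a \<Rightarrow> 'a" where
  "step_on V f v = (if v \<in> V then f v else v)"

lemma funpow_eq_imp_same_start:
  assumes "inj_on f V" "u \<notin> f ` V" "v \<notin> f ` V"
    and "\<And>k. k < i \<Longrightarrow> (f ^^ k) u \<in> V" "\<And>k. k < j \<Longrightarrow> (f ^^ k) v \<in> V"
    and "(f ^^ i) u = (f ^^ j) v"
  shows "i = j \<and> u = v"
  using assms(4-)
proof (induction i arbitrary: j)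
  case 0
  show ?case
  proof (cases j)
    case (Suc l)
    then have "(f ^^ l) v \<in> V" "u = f ((f ^^ l) v)" using "0.prems"(2)[of l] "0.prems"(3) by auto
    with assms(2) show ?thesis by blast
  qed (use "0.prems"(3) in auto)
next
  case (Suc i)
  have u: "(f ^^ i) u \<in> V" using Suc.prems(1) by blast
  show ?case
  proof (cases j)
    case 0
    then have "v = f ((f ^^ i) u)" using Suc.prems(3) by auto
    with u assms(3) show ?thesis by blast
  next
    case (Suc l)
    then have v: "(f ^^ l) v \<in> V" using Suc.prems(2) by blast
    have "f ((f ^^ i) u) = f ((f ^^ l) v)" using Suc.prems(3) Suc by auto
    then have "(f ^^ i) u = (f ^^ l) v" by (rule inj_onD[OF assms(1) _ u v])
    then have "i = l \<and> u = v"
      using Suc.prems(1,2) Suc by (intro Suc.IH) auto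
    then show ?thesis using Suc by blast
  qed
qed

lemma funpow_step_on:
  obtains i where "i \<le> n" "(step_on V f ^^ n) u = (f ^^ i) u" "\<And>k. k < i \<Longrightarrow> (f ^^ k) u \<in> V"
    "i = n \<or> (f ^^ i) u \<notin> V"
proof (induction n arbitrary: thesis)
  case 0
  then show ?case by simp
next
  case (Suc n)
  obtain i where i: "i \<le> n" "(step_on V f ^^ n) u = (f ^^ i) u" "\<And>k. k < i \<Longrightarrow> (f ^^ k) u \<in> V"
    "i = n \<or> (f ^^ i) u \<notin> V"
    using Suc.IH by blast
  have step: "(step_on V f ^^ Suc n) u = step_on V f ((f ^^ i) u)" using i(2) by simp
  show ?case
  proof (cases "(f ^^ i) u \<in> V")
    case True
    show ?thesis
    proof (rule Suc.prems[of "Suc i"])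
      show "(step_on V f ^^ Suc n) u = (f ^^ Suc i) u"
        using True unfolding step by (simp add: step_on_def)
      show "(f ^^ k) u \<in> V" if "k < Suc i" for k using i(3) True that by (metis less_Suc_eq)
    qed (use i(1,4) True in auto)
  next
    case False
    show ?thesis
    proof (rule Suc.prems[of i])
      show "(step_on V f ^^ Suc n) u = (f ^^ i) u"
        using False unfolding step by (simp add: step_on_def)
    qed (use i(1,3) False in auto)
  qed
qed

lemma funpow_step_on_exit:
  assumes "finite A" "V \<subseteq> A" "inj_on f V" "u \<notin> f ` V"
  obtains i where "(step_on V f ^^ card A) u = (f ^^ i) u" "\<And>k. k < i \<Longrightarrow> (f ^^ k) u \<in> V"
    "(f ^^ i) u \<notin> V"
proof -
  obtain i where i: "i \<le> card A" "(step_on V f ^^ card A) u = (f ^^ i) u"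
    "\<And>k. k < i \<Longrightarrow> (f ^^ k) u \<in> V" "i = card A \<or> (f ^^ i) u \<notin> V"
    using funpow_step_on[of "card A" V f u] by blast
  moreover have "(f ^^ i) u \<notin> V"
  proof
    assume "(f ^^ i) u \<in> V"
    then have in_V: "(f ^^ k) u \<in> V" if "k \<le> card A" for k
      using i(3,4) that by (metis le_neq_implies_less)
    have "inj_on (\<lambda>k. (f ^^ k) u) {..card A}"
    proof (rule inj_onI)
      fix k l assume "k \<in> {..card A}" "l \<in> {..card A}" "(f ^^ k) u = (f ^^ l) u"
      with funpow_eq_imp_same_start[OF assms(3,4,4)] in_V show "k = l" by auto
    qed
    moreover have "(\<lambda>k. (f ^^ k) u) ` {..card A} \<subseteq> A" using in_V assms(2) by auto
    ultimately have "card {..card A} \<le> card A" using assms(1) by (rule card_inj_on_le)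
    then show False by simp
  qed
  ultimately show thesis using that by blast
qed

definition matched :: "'a set \<Rightarrow> ('a \<Rightarrow> 'a) \<Rightarrow> ('a \<Rightarrow> 'a) \<Rightarrow> 'a set" where
  "matched A q p = {u \<in> A. q u \<in> A \<and> p (q u) = u}"

lemma inj_on_matched: "inj_on q (matched A q p)"
  by (rule inj_on_inverseI[of _ p]) (simp add: matched_def)

lemma matched_image: "q ` matched A q p = matched A p q"
  by (force simp: matched_def)

text \<open>On a maximal chain of the matching, the unmatched last element is sent back to the first.\<close>

definition close_matching :: "'a set \<Rightarrow> ('a \<Rightarrow> 'a) \<Rightarrow> ('a \<Rightarrow> 'a) \<Rightarrow> 'a \<Rightarrow> 'a" where
  "close_matching A q p u =
     (if u \<in> matched A q p then q u else (step_on (matched A p q) p ^^ card A) u)"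

lemma close_matching_unmatched:
  assumes "finite A" "u \<notin> matched A q p"
  obtains i where "close_matching A q p u = (p ^^ i) u" "\<And>k. k < i \<Longrightarrow> (p ^^ k) u \<in> matched A p q"
    "(p ^^ i) u \<notin> matched A p q"
proof -
  have "matched A p q \<subseteq> A" by (auto simp: matched_def)
  moreover have "u \<notin> p ` matched A p q" using assms(2) by (simp add: matched_image)
  ultimately show thesis
    using funpow_step_on_exit[OF assms(1) _ inj_on_matched[of p A q]] assms(2) that
    unfolding close_matching_def by metis
qed

lemma inj_close_matching:
  assumes "finite A"
  shows "inj (close_matching A q p)"
proof -
  let ?f = "close_matching A q p"
  have matched_neq: "?f u \<noteq> ?f v" if "u \<in> matched A q p" "v \<notin> matched A q p" for u v
  proof -
    have "?f u \<in> matched A p q" using that(1) by (auto simp: close_matching_def matched_def)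
    then show ?thesis using close_matching_unmatched[OF assms that(2)] by metis
  qed
  show ?thesis
  proof (rule injI)
    fix u v assume eq: "?f u = ?f v"
    then consider (both_matched) "u \<in> matched A q p" "v \<in> matched A q p"
      | (both_unmatched) "u \<notin> matched A q p" "v \<notin> matched A q p"
      using matched_neq by metis
    then show "u = v"
    proof cases
      case both_matched
      then show ?thesis using eq inj_onD[OF inj_on_matched] by (metis close_matching_def)
    next
      case both_unmatched
      obtain i where i: "?f u = (p ^^ i) u" "\<And>k. k < i \<Longrightarrow> (p ^^ k) u \<in> matched A p q"
        using close_matching_unmatched[OF assms both_unmatched(1)] by metis
      obtain j where j: "?f v = (p ^^ j) v" "\<And>k. k < j \<Longrightarrow> (p ^^ k) v \<in> matched A p q"
        using close_matching_unmatched[OF assms both_unmatched(2)] by metis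
      show ?thesis
        using funpow_eq_imp_same_start[OF inj_on_matched _ _ i(2) j(2)] both_unmatched eq i(1) j(1)
        by (simp add: matched_image)
    qed
  qed
qed

theorem close_matching_permutes:
  assumes "finite A"
  shows "close_matching A q p permutes A"
proof (rule bij_imp_permutes)
  let ?f = "close_matching A q p"
  have "?f u \<in> A" if "u \<in> A" for u
  proof (cases "u \<in> matched A q p")
    case True
    then show ?thesis by (simp add: close_matching_def matched_def)
  next
    case False
    then obtain i where i: "?f u = (p ^^ i) u" "\<And>k. k < i \<Longrightarrow> (p ^^ k) u \<in> matched A p q"
      using close_matching_unmatched[OF assms] by metis
    show ?thesis
    proof (cases i)
      case 0
      then show ?thesis using i(1) that by simp
    next
      case (Suc k)
      then show ?thesis using i(1) i(2)[of k] by (simp add: matched_def)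
    qed
  qed
  then have "?f ` A \<subseteq> A" by blast
  moreover have "inj_on ?f A"
    using inj_close_matching[OF assms] by (rule inj_on_subset) simp
  ultimately show "bij_betw ?f A A"
    using endo_inj_surj[OF assms] by (simp add: bij_betw_def)
next
  fix u assume "u \<notin> A"
  then have "u \<notin> matched A q p" "u \<notin> matched A p q" by (simp_all add: matched_def)
  with close_matching_unmatched[OF assms this(1)] show "close_matching A q p u = u"
    by (metis funpow_0 gr0I)
qed

section \<open>The upper bound\<close>

definition follow_match :: "language \<Rightarrow> nat \<Rightarrow> nat \<Rightarrow> nat \<Rightarrow> nat \<Rightarrow> nat \<Rightarrow> nat option" where
  "follow_match U N Q P u d = do {
     v \<leftarrow> run_code U Q u;
     u' \<leftarrow> run_code U P v;
     Some (if u < N \<and> v < N \<and> u' = u then v else d)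
   }"

definition run_close_matching :: "language \<Rightarrow> nat \<Rightarrow> nat \<Rightarrow> nat \<Rightarrow> nat \<Rightarrow> nat option" where
  "run_close_matching U N Q P u = do {
     e \<leftarrow> rec_nat (Some u) (\<lambda>_ r. r \<bind> (\<lambda>v. follow_match U N P Q v v)) N;
     follow_match U N Q P u e
   }"

lemma partial_recursive_follow_match [recursive_intros]:
  assumes "programming_language U" "total_recursive a" "total_recursive b" "total_recursive c"
    "total_recursive d" "total_recursive e"
  shows "partial_recursive (\<lambda>n. follow_match U (a n) (b n) (c n) (d n) (e n))"
  unfolding follow_match_def
  by (intro recursive_intros assms assms(2-)[THEN total_recursive_comp])

lemma partial_recursive_run_close_matching [recursive_intros]:
  assumes "programming_language U" "total_recursive a" "total_recursive b" "total_recursive c"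
    "total_recursive d"
  shows "partial_recursive (\<lambda>n. run_close_matching U (a n) (b n) (c n) (d n))"
  unfolding run_close_matching_def
  by (intro partial_recursive_rec_nat recursive_intros assms assms(2-)[THEN total_recursive_comp])

lemma follow_match_eq:
  assumes "\<And>v. run_code U Q v = Some (q v)" "\<And>v. run_code U P v = Some (p v)"
  shows "follow_match U N Q P u d = Some (if u \<in> matched {..<N} q p then q u else d)"
  by (simp add: follow_match_def assms matched_def)

lemma run_close_matching_eq:
  assumes q: "\<And>v. run_code U Q v = Some (q v)" and p: "\<And>v. run_code U P v = Some (p v)"
  shows "run_close_matching U N Q P u = Some (close_matching {..<N} q p u)"
proof -
  have "rec_nat (Some u) (\<lambda>_ r. r \<bind> (\<lambda>v. follow_match U N P Q v v)) k =
      Some ((step_on (matched {..<N} p q) p ^^ k) u)" for k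
    by (induction k) (simp_all add: follow_match_eq[OF p q] step_on_def[of "matched {..<N} p q"])
  then show ?thesis
    by (simp add: run_close_matching_def follow_match_eq[OF q p] close_matching_def)
qed

text \<open>\<open>r\<close> packs a description of \<open>p\<close>, whose code is below \<open>2 ^ l\<close>, and one of \<open>q\<close>; the strings of
  length at most \<open>n\<close> have codes below \<open>2 ^ Suc n\<close>.\<close>

definition closing_program :: "language \<Rightarrow> nat \<Rightarrow> nat \<Rightarrow> nat \<Rightarrow> nat \<Rightarrow> nat option" where
  "closing_program U l n r u = do {
     P \<leftarrow> run_code U (r mod 2 ^ l) 0;
     Q \<leftarrow> run_code U (r div 2 ^ l) 0;
     run_close_matching U (2 ^ Suc n) Q P u
   }"

lemma partial_recursive_closing_program:
  assumes "programming_language U" "total_recursive a" "total_recursive b" "total_recursive c"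
    "total_recursive d"
  shows "partial_recursive (\<lambda>e. closing_program U (a e) (b e) (c e) (d e))"
  unfolding closing_program_def
  by (intro recursive_intros assms assms(2-)[THEN total_recursive_comp])

definition map_code :: "language \<Rightarrow> bool list \<Rightarrow> nat \<Rightarrow> nat" where
  "map_code U p u = the (run_code U (str_code p) u)"

lemma run_code_total_program:
  "total_program U p \<Longrightarrow> run_code U (str_code p) u = Some (map_code U p u)"
  by (auto simp: map_code_def run_code_def total_program_def)

lemma map_code_eq: "U p x = Some y \<Longrightarrow> map_code U p (str_code x) = str_code y"
  by (simp add: map_code_def run_code_def)

lemma closing_program_eq:
  assumes "total_program U p" "total_program U q"
    and "run_code U d 0 = Some (str_code p)" "run_code U d' 0 = Some (str_code q)" "d < 2 ^ l"
  shows "closing_program U l n (d + 2 ^ l * d') u =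
    Some (close_matching {..<2 ^ Suc n} (map_code U q) (map_code U p) u)"
  using assms(3-)
    run_close_matching_eq[OF assms(2,1)[THEN run_code_total_program], of "2 ^ Suc n" u]
  by (simp add: closing_program_def)

lemma computes_permutation_close_matching:
  assumes "\<And>u. run_code U t u = Some (close_matching A q p u)" "finite A"
  shows "computes_permutation U (str_decode t)"
proof -
  let ?f = "str_decode \<circ> close_matching A q p \<circ> str_code"
  have "bij ?f"
    using permutes_bij[OF close_matching_permutes[OF assms(2)]]
    by (intro bij_comp bij_str_code bij_imp_bij_inv)
  moreover have "U (str_decode t) z = Some (?f z)" for z
    using assms(1)[of "str_code z"] by (simp add: run_code_eq_Some_iff)
  ultimately show ?thesis unfolding computes_permutation_def by blast
qed

lemma closing_program_maps:
  assumes p: "total_program U p" "U p y = Some x" "run_code U d 0 = Some (str_code p)" "d < 2 ^ l"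
    and q: "total_program U q" "U q x = Some y" "run_code U d' 0 = Some (str_code q)"
    and len: "length x \<le> n" "length y \<le> n"
    and run: "\<And>u. run_code U t u = closing_program U l n (d + 2 ^ l * d') u"
  shows "computes_permutation U (str_decode t) \<and> U (str_decode t) x = Some y"
proof
  let ?A = "{..<2 ^ Suc n}"
  have t: "run_code U t u = Some (close_matching ?A (map_code U q) (map_code U p) u)" for u
    unfolding run by (rule closing_program_eq[OF p(1) q(1) p(3) q(3) p(4)])
  then show "computes_permutation U (str_decode t)"
    by (rule computes_permutation_close_matching) simp
  have "str_code x \<in> ?A" "str_code y \<in> ?A"
    using len length_less_iff_str_code[of x "Suc n"] length_less_iff_str_code[of y "Suc n"]
    by simp_all
  moreover have image: "map_code U q (str_code x) = str_code y"
    "map_code U p (str_code y) = str_code x"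
    by (intro map_code_eq p(2) q(2))+
  ultimately have "str_code x \<in> matched ?A (map_code U q) (map_code U p)"
    unfolding matched_def by simp
  then have "run_code U t (str_code x) = Some (str_code y)"
    by (simp only: t close_matching_def image if_True)
  then show "U (str_decode t) x = Some y" by (simp add: run_code_eq_Some_iff)
qed

lemma goedel_language_closing_program:
  assumes "goedel_language U"
  shows "\<exists>h. total_recursive h \<and> (\<forall>l n r u.
    run_code U (h (prod_encode (prod_encode (l, n), r))) u = closing_program U l n r u)"
proof -
  have "partial_recursive (\<lambda>e.
      closing_program U (pfst (pfst (pfst e))) (psnd (pfst (pfst e))) (psnd (pfst e)) (psnd e))"
    using assms unfolding goedel_language_def
    by (intro partial_recursive_closing_program recursive_intros) blast
  from goedel_language_smn[OF assms this] show ?thesis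
    by (metis fst_conv prod_encode_inverse snd_conv)
qed

lemma total_cond_complexity_attained:
  assumes "total_cond_complexity U x y = enat a"
  obtains p d where "total_program U p" "U p y = Some x"
    "run_code U d 0 = Some (str_code p)" "d < 2 ^ Suc a"
proof -
  have "total_cond_complexity U x y < enat (Suc a)" using assms by simp
  then show thesis unfolding total_cond_complexity_less_iff using that by (metis Suc_lessD)
qed

lemma concatenated_descriptions_less:
  fixes N d d' :: nat
  assumes "2 \<le> N" "2 \<le> e" "d < 2 ^ Suc a" "d' < 2 ^ Suc b"
  shows "d + 2 ^ Suc a * d' < N ^ e * 2 ^ (a + b)"
proof -
  have "d + 2 ^ Suc a * d' < 2 ^ Suc a * 2 ^ Suc b" by (rule mixed_radix_less[OF assms(3,4)])
  also have "\<dots> = 2 ^ 2 * 2 ^ (a + b)" by (simp add: power_add)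
  also have "(2::nat) ^ 2 \<le> N ^ e"
    by (rule order_trans[OF power_mono[OF assms(1)] power_increasing]) (use assms in simp_all)
  finally show ?thesis by simp
qed

lemma ex_permutation_complexity_le:
  assumes "optimal_language U" "goedel_language U"
  shows "\<exists>c. \<forall>n x y a b. 2 \<le> n \<longrightarrow> length x \<le> n \<longrightarrow> length y \<le> n \<longrightarrow>
    total_cond_complexity U x y = enat a \<longrightarrow> total_cond_complexity U y x = enat b \<longrightarrow> a \<le> n + e \<longrightarrow>
    (\<exists>t. computes_permutation U t \<and> U t x = Some y \<and>
      ereal_of_enat (complexity U t) \<le> ereal (real (a + b) + c * log 2 (real n)))"
proof -
  obtain h where h_rec: "total_recursive h" and h: "\<And>l n r u.
      run_code U (h (prod_encode (prod_encode (l, n), r))) u = closing_program U l n r u"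
    using goedel_language_closing_program[OF assms(2)] by blast
  define D where "D = 2 * (Suc e + 3)"
  obtain c where c: "\<And>m r n b. 2 \<le> n \<Longrightarrow> m < n ^ D \<Longrightarrow> r < n ^ D * 2 ^ b \<Longrightarrow>
      ereal_of_enat (complexity U (str_decode (h (prod_encode (m, r)))))
        \<le> ereal (real b + c * log 2 (real n))"
    using complexity_pair_le_log[OF assms(1) partial_recursive_Some[OF h_rec], of D] by blast
  have "\<exists>t. computes_permutation U t \<and> U t x = Some y \<and>
      ereal_of_enat (complexity U t) \<le> ereal (real (a + b) + c * log 2 (real n))"
    if n: "2 \<le> n" and len: "length x \<le> n" "length y \<le> n"
      and a: "total_cond_complexity U x y = enat a" "a \<le> n + e"
      and b: "total_cond_complexity U y x = enat b" for n x y a b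
  proof -
    obtain p d where p: "total_program U p" "U p y = Some x"
      "run_code U d 0 = Some (str_code p)" "d < 2 ^ Suc a"
      using total_cond_complexity_attained[OF a(1)] .
    obtain q d' where q: "total_program U q" "U q x = Some y"
      "run_code U d' 0 = Some (str_code q)" "d' < 2 ^ Suc b"
      using total_cond_complexity_attained[OF b] .
    have "prod_encode (Suc a, n) < n ^ D"
      unfolding D_def using a(2) by (intro prod_encode_less_power n) simp_all
    moreover have "d + 2 ^ Suc a * d' < n ^ D * 2 ^ (a + b)"
      by (rule concatenated_descriptions_less[OF n _ p(4) q(4)]) (simp add: D_def)
    ultimately show ?thesis
      using c[OF n] closing_program_maps[OF p(1-4) q(1-3) len h] by blast
  qed
  then show ?thesis by blast
qed

theorem permutation_upper_bound:
  assumes "optimal_language U" "goedel_language U"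
  shows "\<exists>c. \<forall>n\<ge>2. \<forall>x y. length x \<le> n \<and> length y \<le> n \<longrightarrow>
    (\<exists>t. computes_permutation U t \<and> U t x = Some y \<and>
      ereal_of_enat (complexity U t) \<le> ereal_of_enat (total_cond_complexity U x y)
        + ereal_of_enat (total_cond_complexity U y x) + ereal (c * log 2 (real n)))"
proof -
  obtain e where e: "\<And>x y. total_cond_complexity U x y \<le> enat (length x + e)"
    using total_cond_complexity_le_length[OF assms] by blast
  obtain c where c: "\<And>n x y a b. \<lbrakk>2 \<le> n; length x \<le> n; length y \<le> n;
      total_cond_complexity U x y = enat a; total_cond_complexity U y x = enat b; a \<le> n + e\<rbrakk> \<Longrightarrow>
      \<exists>t. computes_permutation U t \<and> U t x = Some y \<and>
        ereal_of_enat (complexity U t) \<le> ereal (real (a + b) + c * log 2 (real n))"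
    using ex_permutation_complexity_le[OF assms, of e] by blast
  have "\<exists>t. computes_permutation U t \<and> U t x = Some y \<and>
      ereal_of_enat (complexity U t) \<le> ereal_of_enat (total_cond_complexity U x y)
        + ereal_of_enat (total_cond_complexity U y x) + ereal (c * log 2 (real n))"
    if n: "2 \<le> n" and len: "length x \<le> n" "length y \<le> n" for n x y
  proof -
    obtain a where a: "total_cond_complexity U x y = enat a" "a \<le> n + e"
      using e[of x y] len(1) by (cases "total_cond_complexity U x y") auto
    obtain b where b: "total_cond_complexity U y x = enat b"
      using e[of y x] by (cases "total_cond_complexity U y x") auto
    show ?thesis using c[OF n len a(1) b a(2)] by (simp add: a(1) b)
  qed
  then show ?thesis by blast
qed

section \<open>The lower bound\<close>

lemma ex_card_le_average:
  assumes "finite I" "I \<noteq> {}" "finite T" and "\<And>p. p \<in> T \<Longrightarrow> card {i \<in> I. R i p} \<le> a"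
  shows "\<exists>i\<in>I. card I * card {p \<in> T. R i p} \<le> card T * a"
proof -
  obtain i where i: "i \<in> I" "\<And>j. j \<in> I \<Longrightarrow> card {p \<in> T. R i p} \<le> card {p \<in> T. R j p}"
    using ex_is_arg_min_if_finite[OF assms(1,2), of "\<lambda>i. card {p \<in> T. R i p}"]
    by (auto simp: is_arg_min_linorder)
  then have "card I * card {p \<in> T. R i p} \<le> (\<Sum>j\<in>I. card {p \<in> T. R j p})"
    using sum_bounded_below[of I "card {p \<in> T. R i p}"] by simp
  also have "\<dots> = (\<Sum>p\<in>T. card {i \<in> I. R i p})"
    by (intro sum_multicount_gen assms ballI refl)
  also have "\<dots> \<le> card T * a"
    using sum_bounded_above[of T "\<lambda>p. card {i \<in> I. R i p}" a] assms(4) by simp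
  finally show ?thesis using i(1) by blast
qed

lemma ex_missed_value:
  assumes "finite T" "T0 \<subseteq> T" "finite W"
    and "card {p \<in> T0. \<exists>w\<in>W. v p = Some w} + card (T - T0) < card W"
  shows "\<exists>w\<in>W. \<forall>p\<in>T. v p \<noteq> Some w"
proof (rule ccontr)
  let ?H = "{p \<in> T0. \<exists>w\<in>W. v p = Some w} \<union> (T - T0)"
  assume "\<not> ?thesis"
  then have "W \<subseteq> (the \<circ> v) ` ?H" by (force simp: image_iff)
  then have "card W \<le> card ?H"
    using assms(1,2) by (intro surj_card_le) (auto intro: finite_subset)
  also have "\<dots> \<le> card {p \<in> T0. \<exists>w\<in>W. v p = Some w} + card (T - T0)" by (rule card_Un_le)
  finally show False using assms(4) by simp
qed

definition target_codes :: "nat \<Rightarrow> nat \<Rightarrow> nat set" where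
  "target_codes k n = {2 ^ n - 1..<2 ^ n - 1 + 2 ^ Suc k}"

text \<open>\<open>F (prod_encode (p, u))\<close> is what the program described by \<open>p\<close> outputs on \<open>u\<close>; \<open>F\<close> stands for
  this partial function as well as for its finite stages.\<close>

definition hits :: "(nat \<rightharpoonup> nat) \<Rightarrow> nat \<Rightarrow> nat \<Rightarrow> nat \<Rightarrow> nat set" where
  "hits F k n p = {u \<in> string_codes n. \<exists>v\<in>target_codes k n. F (prod_encode (p, u)) = Some v}"

definition candidates :: "(nat \<rightharpoonup> nat) \<Rightarrow> nat \<Rightarrow> nat \<Rightarrow> nat set" where
  "candidates F k n = {p. p < 4 ^ k \<and> (\<forall>u\<in>string_codes n. F (prod_encode (p, u)) \<noteq> None) \<and>
     card (hits F k n p) \<le> 2 ^ Suc k}"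

definition hitters :: "(nat \<rightharpoonup> nat) \<Rightarrow> nat \<Rightarrow> nat \<Rightarrow> nat \<Rightarrow> nat set" where
  "hitters F k n u = {p \<in> candidates F k n. u \<in> hits F k n p}"

lemma finite_candidates: "finite (candidates F k n)"
  and card_candidates_le: "card (candidates F k n) \<le> 4 ^ k"
proof -
  have "candidates F k n \<subseteq> {..<4 ^ k}" by (auto simp: candidates_def)
  then show "finite (candidates F k n)" "card (candidates F k n) \<le> 4 ^ k"
    using card_mono[of "{..<4 ^ k :: nat}" "candidates F k n"] by (simp_all add: finite_subset)
qed

lemma finite_target_codes: "finite (target_codes k n)"
  and card_target_codes: "card (target_codes k n) = 2 ^ Suc k"
  by (simp_all add: target_codes_def)

lemma target_codes_subset: "k < n \<Longrightarrow> target_codes k n \<subseteq> string_codes n"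
  using power_increasing[of "Suc k" n "2::nat"] by (auto simp: target_codes_def string_codes_def)

lemma candidates_agree:
  assumes "p \<in> candidates F k n" "F \<subseteq>\<^sub>m F'" "u \<in> string_codes n"
  shows "F' (prod_encode (p, u)) = F (prod_encode (p, u))"
  using assms by (auto simp: candidates_def map_le_iff_Some)

lemma candidates_mono:
  assumes "F \<subseteq>\<^sub>m F'"
  shows "candidates F k n \<subseteq> candidates F' k n"
proof
  fix p assume p: "p \<in> candidates F k n"
  have "hits F' k n p = hits F k n p"
    using candidates_agree[OF p assms] by (auto simp: hits_def)
  with p candidates_agree[OF p assms] show "p \<in> candidates F' k n"
    by (simp add: candidates_def)
qed

lemma candidates_eventually:
  assumes "approximates g f"
  shows "\<forall>\<^sub>F s in sequentially. candidates (g s) k n = candidates f k n"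
proof -
  have "\<forall>\<^sub>F s in sequentially. \<forall>p\<in>candidates f k n. \<forall>u\<in>string_codes n.
      g s (prod_encode (p, u)) = f (prod_encode (p, u))"
  proof (intro eventually_ball_finite ballI finite_candidates)
    fix p u assume "p \<in> candidates f k n" "u \<in> string_codes n"
    then show "\<forall>\<^sub>F s in sequentially. g s (prod_encode (p, u)) = f (prod_encode (p, u))"
      using approximates_eventually[OF assms] by (auto simp: candidates_def)
  qed (simp_all add: finite_string_codes)
  then show ?thesis
  proof eventually_elim
    case (elim s)
    then have "candidates f k n \<subseteq> candidates (g s) k n"
      by (auto simp: candidates_def hits_def cong: conj_cong)
    with candidates_mono[OF approximates_map_le[OF assms]] show ?case by blast
  qed
qed

lemma inj_in_candidates:
  assumes "p < 4 ^ k" "\<And>u. f (prod_encode (p, u)) = Some (\<phi> u)" "inj \<phi>"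
  shows "p \<in> candidates f k n"
proof -
  have "card (hits f k n p) \<le> card (target_codes k n)"
  proof (rule card_inj_on_le)
    show "inj_on \<phi> (hits f k n p)" using assms(3) by (rule inj_on_subset) simp
    show "\<phi> ` hits f k n p \<subseteq> target_codes k n" by (auto simp: hits_def assms(2))
  qed (rule finite_target_codes)
  then show ?thesis using assms(1,2) by (simp add: candidates_def card_target_codes)
qed

lemma ex_rarely_hitting:
  assumes "2 * k < n"
  shows "\<exists>u\<in>string_codes n. card (hitters F k n u) \<le> 2 ^ k"
proof -
  have "\<exists>u\<in>string_codes n. card (string_codes n) * card {p \<in> candidates F k n. u \<in> hits F k n p}
      \<le> card (candidates F k n) * 2 ^ Suc k"
  proof (rule ex_card_le_average[OF finite_string_codes _ finite_candidates])
    show "string_codes n \<noteq> {}" using card_string_codes[of n] by force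
    show "card {u \<in> string_codes n. u \<in> hits F k n p} \<le> 2 ^ Suc k" if "p \<in> candidates F k n" for p
    proof -
      have "{u \<in> string_codes n. u \<in> hits F k n p} = hits F k n p" by (auto simp: hits_def)
      then show ?thesis using that by (simp add: candidates_def)
    qed
  qed
  then obtain u where u: "u \<in> string_codes n"
    "2 ^ n * card (hitters F k n u) \<le> card (candidates F k n) * 2 ^ Suc k"
    unfolding hitters_def card_string_codes by blast
  have "2 ^ Suc (2 * k) * card (hitters F k n u) \<le> 2 ^ n * card (hitters F k n u)"
    using assms by (intro mult_right_mono power_increasing) auto
  also have "\<dots> \<le> card (candidates F k n) * 2 ^ Suc k" by (rule u(2))
  also have "\<dots> \<le> 4 ^ k * 2 ^ Suc k" by (intro mult_right_mono card_candidates_le) simp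
  also have "\<dots> = 2 ^ Suc (2 * k) * 2 ^ k" by (simp add: power_mult)
  finally show ?thesis using u(1) by auto
qed

lemma ex_missed_target:
  assumes "F \<subseteq>\<^sub>m f" "u \<in> string_codes n" "card (hitters F k n u) \<le> 2 ^ k"
    and "card (candidates f k n) < card (candidates F k n) + 2 ^ k"
  shows "\<exists>v\<in>target_codes k n. \<forall>p\<in>candidates f k n. f (prod_encode (p, u)) \<noteq> Some v"
proof (rule ex_missed_value)
  show sub: "candidates F k n \<subseteq> candidates f k n" by (rule candidates_mono[OF assms(1)])
  have "{p \<in> candidates F k n. \<exists>v\<in>target_codes k n. f (prod_encode (p, u)) = Some v} =
      hitters F k n u"
    using candidates_agree[OF _ assms(1,2)] assms(2) by (auto simp: hitters_def hits_def)
  moreover have "card (candidates f k n - candidates F k n) < 2 ^ k"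
    using assms(4) card_Diff_subset[OF finite_candidates sub] card_mono[OF finite_candidates sub]
    by linarith
  ultimately show "card {p \<in> candidates F k n.
        \<exists>v\<in>target_codes k n. f (prod_encode (p, u)) = Some v} +
      card (candidates f k n - candidates F k n) < card (target_codes k n)"
    using assms(3) by (simp add: card_target_codes)
qed (simp_all add: finite_candidates finite_target_codes)

text \<open>If \<open>j\<close> is the number of all candidates divided by \<open>2 ^ k\<close>, then fewer than \<open>2 ^ k\<close> of them are
  missed at the stage found.\<close>

definition rarely_hitting :: "(nat \<Rightarrow> nat \<rightharpoonup> nat) \<Rightarrow> nat \<Rightarrow> nat \<Rightarrow> nat \<Rightarrow> nat option" where
  "rarely_hitting g k n j = do {
     s \<leftarrow> least_option (\<lambda>s. j * 2 ^ k \<le> card (candidates (g s) k n));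
     least_option (\<lambda>u. u \<in> string_codes n \<and> card (hitters (g s) k n u) \<le> 2 ^ k)
   }"

lemma rarely_hitting_missed_target:
  assumes g: "approximates g f" and "2 * k < n"
  shows "\<exists>j\<le>2 ^ k. \<exists>u\<in>string_codes n. \<exists>v\<in>target_codes k n.
    rarely_hitting g k n j = Some u \<and> (\<forall>p\<in>candidates f k n. f (prod_encode (p, u)) \<noteq> Some v)"
proof -
  define j where "j = card (candidates f k n) div 2 ^ k"
  define s where "s = (LEAST s. j * 2 ^ k \<le> card (candidates (g s) k n))"
  define u where "u = (LEAST u. u \<in> string_codes n \<and> card (hitters (g s) k n u) \<le> 2 ^ k)"
  have "j \<le> (2 ^ k * 2 ^ k) div 2 ^ k"
    unfolding j_def using card_candidates_le[of f k n]
    by (intro div_le_mono) (simp flip: power_mult_distrib)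
  then have j: "j \<le> 2 ^ k" by simp
  obtain S where "candidates (g S) k n = candidates f k n"
    using eventually_happens'[OF sequentially_bot candidates_eventually[OF g]] by blast
  then have ex_s: "\<exists>s. j * 2 ^ k \<le> card (candidates (g s) k n)"
    by (intro exI[of _ S]) (simp add: j_def)
  then have "j * 2 ^ k \<le> card (candidates (g s) k n)"
    unfolding s_def by (rule LeastI_ex)
  moreover have "card (candidates f k n) < j * 2 ^ k + 2 ^ k"
    unfolding j_def using dividend_less_div_times[of "2 ^ k" "card (candidates f k n)"] by simp
  ultimately have found: "card (candidates f k n) < card (candidates (g s) k n) + 2 ^ k" by linarith
  have ex_u: "\<exists>u. u \<in> string_codes n \<and> card (hitters (g s) k n u) \<le> 2 ^ k"
    using ex_rarely_hitting[OF assms(2)] by blast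
  then have u: "u \<in> string_codes n \<and> card (hitters (g s) k n u) \<le> 2 ^ k"
    unfolding u_def by (rule LeastI_ex)
  have "rarely_hitting g k n j = Some u"
    using ex_s ex_u by (simp add: rarely_hitting_def least_option_def flip: s_def u_def)
  with j u ex_missed_target[OF approximates_map_le[OF g] _ _ found] show ?thesis by blast
qed

context
  fixes g :: "nat \<Rightarrow> nat \<rightharpoonup> nat" and f :: "nat \<rightharpoonup> nat"
  assumes approx: "approximates g f"
begin

lemma decidable_hits:
  assumes "total_recursive a" "total_recursive b" "total_recursive c" "total_recursive d"
    "total_recursive e"
  shows "decidable (\<lambda>x. e x \<in> hits (g (a x)) (b x) (c x) (d x))"
proof -
  have "m < option_code r \<and> option_code r \<le> m + l \<longleftrightarrow>
      (\<exists>v\<in>{m..<m + l}. r = Some v)" for r m l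
    by (cases r) auto
  then have "u \<in> hits (g s) k n p \<longleftrightarrow> (2 ^ n - 1 \<le> u \<and> u < 2 ^ Suc n - 1) \<and>
      2 ^ n - 1 < option_code (g s (prod_encode (p, u))) \<and>
      option_code (g s (prod_encode (p, u))) \<le> 2 ^ n - 1 + 2 ^ Suc k" for u s k n p
    unfolding hits_def string_codes_def target_codes_def mem_Collect_eq atLeastLessThan_iff
    by presburger
  then show ?thesis
    by (simp only:) (intro recursive_intros total_recursive_approximation[OF approx] assms)
qed

lemma total_recursive_card_hits:
  assumes "total_recursive a" "total_recursive b" "total_recursive c" "total_recursive d"
  shows "total_recursive (\<lambda>x. card (hits (g (a x)) (b x) (c x) (d x)))"
proof -
  have "{u. u < 2 ^ Suc n - 1 \<and> u \<in> hits F k n p} = hits F k n p" for F k n p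
    by (auto simp: hits_def string_codes_def)
  moreover have "total_recursive (\<lambda>x.
      card {u. u < 2 ^ Suc (c x) - 1 \<and> u \<in> hits (g (a x)) (b x) (c x) (d x)})"
    by (intro recursive_intros decidable_hits assms assms[THEN total_recursive_comp])
  ultimately show ?thesis by (simp only:)
qed

lemma decidable_candidates:
  assumes "total_recursive a" "total_recursive b" "total_recursive c" "total_recursive d"
  shows "decidable (\<lambda>x. d x \<in> candidates (g (a x)) (b x) (c x))"
proof -
  have "option_code r = 0 \<longleftrightarrow> r = None" for r by (cases r) simp_all
  then have "p \<in> candidates (g s) k n \<longleftrightarrow> p < 4 ^ k \<and>
      (\<forall>u<2 ^ Suc n - 1. \<not> (2 ^ n - 1 \<le> u \<and> option_code (g s (prod_encode (p, u))) = 0)) \<and>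
      card (hits (g s) k n p) \<le> 2 ^ Suc k" for p s k n
    by (auto simp: candidates_def string_codes_def)
  then show ?thesis
    by (simp only:) (intro recursive_intros total_recursive_approximation[OF approx]
        total_recursive_card_hits assms assms[THEN total_recursive_comp])
qed

lemma total_recursive_card_candidates:
  assumes "total_recursive a" "total_recursive b" "total_recursive c"
  shows "total_recursive (\<lambda>x. card (candidates (g (a x)) (b x) (c x)))"
proof -
  have "{p. p < 4 ^ k \<and> p \<in> candidates F k n} = candidates F k n" for F k n
    by (auto simp: candidates_def)
  moreover have "total_recursive (\<lambda>x. card {p. p < 4 ^ b x \<and> p \<in> candidates (g (a x)) (b x) (c x)})"
    by (intro recursive_intros decidable_candidates assms assms[THEN total_recursive_comp])
  ultimately show ?thesis by (simp only:)
qed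

lemma total_recursive_card_hitters:
  assumes "total_recursive a" "total_recursive b" "total_recursive c" "total_recursive d"
  shows "total_recursive (\<lambda>x. card (hitters (g (a x)) (b x) (c x) (d x)))"
proof -
  have "{p. p < 4 ^ k \<and> p \<in> candidates F k n \<and> u \<in> hits F k n p} = hitters F k n u" for F k n u
    by (auto simp: hitters_def candidates_def)
  moreover have "total_recursive (\<lambda>x. card {p. p < 4 ^ b x \<and> p \<in> candidates (g (a x)) (b x) (c x) \<and>
      d x \<in> hits (g (a x)) (b x) (c x) p})"
    by (intro recursive_intros decidable_candidates decidable_hits assms
        assms[THEN total_recursive_comp])
  ultimately show ?thesis by (simp only:)
qed

lemma partial_recursive_rarely_hitting:
  assumes "total_recursive a" "total_recursive b" "total_recursive c"
  shows "partial_recursive (\<lambda>x. rarely_hitting g (a x) (b x) (c x))"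
  unfolding rarely_hitting_def string_codes_def atLeastLessThan_iff
  by (intro recursive_intros total_recursive_card_candidates total_recursive_card_hitters
      assms assms[THEN total_recursive_comp])

end

definition run_described :: "language \<Rightarrow> nat \<rightharpoonup> nat" where
  "run_described U e = do { t \<leftarrow> run_code U (pfst e) 0; run_code U t (psnd e) }"

lemma partial_recursive_run_described:
  "programming_language U \<Longrightarrow> partial_recursive (run_described U)"
  unfolding run_described_def[abs_def] by (intro recursive_intros)

lemma complexity_ge_if_missed:
  assumes missed: "\<forall>p\<in>candidates (run_described U) k n.
      run_described U (prod_encode (p, str_code x)) \<noteq> Some (str_code y)"
    and t: "computes_permutation U t" "U t x = Some y"
  shows "enat (2 * k) \<le> complexity U t"
proof (rule ccontr)
  assume "\<not> ?thesis"
  then obtain d where d: "Suc d < 2 ^ (2 * k)" "run_code U d 0 = Some (str_code t)"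
    unfolding not_le complexity_less_iff by blast
  obtain \<phi> where \<phi>: "bij \<phi>" "\<And>z. U t z = Some (\<phi> z)"
    using t(1) unfolding computes_permutation_def by blast
  have run: "run_described U (prod_encode (d, u)) = Some ((str_code \<circ> \<phi> \<circ> str_decode) u)" for u
    by (simp add: run_described_def d(2)) (simp add: run_code_def \<phi>(2))
  have "inj (str_code \<circ> \<phi> \<circ> str_decode)"
    by (intro bij_is_inj bij_comp \<phi>(1) bij_str_code bij_imp_bij_inv)
  moreover have "d < 4 ^ k" using d(1) by (simp add: power_mult)
  ultimately have "d \<in> candidates (run_described U) k n" using run by (intro inj_in_candidates)
  moreover have "run_described U (prod_encode (d, str_code x)) = Some (str_code y)"
    using run[of "str_code x"] \<phi>(2)[of x] t(2) by simp
  ultimately show False using missed by blast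
qed

lemma ex_strings_missed_by_permutations:
  assumes "approximates g (run_described U)" "2 * k < n"
  obtains x y j where "length x = n" "length y = n" "j \<le> 2 ^ k"
    "rarely_hitting g k n j = Some (str_code x)" "str_code y \<in> target_codes k n"
    "\<And>t. computes_permutation U t \<Longrightarrow> U t x = Some y \<Longrightarrow> enat (2 * k) \<le> complexity U t"
proof -
  obtain j u v where j: "j \<le> 2 ^ k" and u: "u \<in> string_codes n" "rarely_hitting g k n j = Some u"
    and v: "v \<in> target_codes k n"
    and missed: "\<forall>p\<in>candidates (run_described U) k n. run_described U (prod_encode (p, u)) \<noteq> Some v"
    using rarely_hitting_missed_target[OF assms] by blast
  have "v \<in> string_codes n" using v target_codes_subset[of k n] assms(2) by auto
  show thesis
  proof (rule that[of "str_decode u" "str_decode v" j])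
    show "length (str_decode u) = n" "length (str_decode v) = n"
      using u(1) \<open>v \<in> string_codes n\<close> string_codes_iff by (metis str_code_decode)+
    show "enat (2 * k) \<le> complexity U t"
      if "computes_permutation U t" "U t (str_decode u) = Some (str_decode v)" for t
      using complexity_ge_if_missed[OF _ that] missed by simp
  qed (simp_all add: j u v)
qed

lemma complexity_le_of_parameters:
  assumes "optimal_language U" "partial_recursive f"
  shows "\<exists>c. \<forall>k n j x. f (prod_encode (prod_encode (k, n), j)) = Some x \<longrightarrow> k \<le> n \<longrightarrow> j < 2 ^ Suc k \<longrightarrow>
    ereal_of_enat (complexity U (str_decode x)) \<le> ereal (real k + c * log 2 (real (max n 2)))"
proof -
  obtain c where c: "\<And>m r x N b. f (prod_encode (m, r)) = Some x \<Longrightarrow> 2 \<le> N \<Longrightarrow> m < N ^ 6 \<Longrightarrow>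
      r < N ^ 6 * 2 ^ b \<Longrightarrow>
      ereal_of_enat (complexity U (str_decode x)) \<le> ereal (real b + c * log 2 (real N))"
    using complexity_pair_le_log[OF assms] by blast
  have "ereal_of_enat (complexity U (str_decode x)) \<le> ereal (real k + c * log 2 (real (max n 2)))"
    if "f (prod_encode (prod_encode (k, n), j)) = Some x" "k \<le> n" "j < 2 ^ Suc k" for k n j x
  proof (rule c[OF that(1)])
    show "prod_encode (k, n) < max n 2 ^ 6"
      using prod_encode_less_power[of "max n 2" k 0 n] that(2) by simp
    have "2 ^ Suc k \<le> max n 2 ^ 6 * 2 ^ k"
      using power_mono[of 2 "max n 2" 6] by simp
    with that(3) show "j < max n 2 ^ 6 * 2 ^ k" by (rule less_le_trans)
  qed simp
  then show ?thesis by blast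
qed

lemma complexity_target_le:
  assumes "optimal_language U"
  shows "\<exists>c. \<forall>k n y. str_code y \<in> target_codes k n \<longrightarrow> k \<le> n \<longrightarrow>
    ereal_of_enat (complexity U y) \<le> ereal (real k + c * log 2 (real (max n 2)))"
proof -
  have "partial_recursive (\<lambda>e. Some (2 ^ psnd (pfst e) - 1 + psnd e))"
    by (intro recursive_intros)
  from complexity_le_of_parameters[OF assms this] obtain c
    where c: "\<And>k n j. k \<le> n \<Longrightarrow> j < 2 ^ Suc k \<Longrightarrow>
      ereal_of_enat (complexity U (str_decode (2 ^ n - 1 + j)))
        \<le> ereal (real k + c * log 2 (real (max n 2)))"
    by (metis fst_conv prod_encode_inverse snd_conv)
  have "ereal_of_enat (complexity U y) \<le> ereal (real k + c * log 2 (real (max n 2)))"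
    if "str_code y \<in> target_codes k n" "k \<le> n" for k n y
  proof -
    define j where "j = str_code y - (2 ^ n - 1)"
    have "j < 2 ^ Suc k" "2 ^ n - 1 + j = str_code y"
      using that(1) unfolding j_def target_codes_def atLeastLessThan_iff by linarith+
    with c[OF that(2), of j] show ?thesis by (simp only: str_decode_code)
  qed
  then show ?thesis by blast
qed

lemma complexity_rarely_hitting_le:
  assumes "optimal_language U" "approximates g f"
  shows "\<exists>c. \<forall>k n j x. rarely_hitting g k n j = Some (str_code x) \<longrightarrow> k \<le> n \<longrightarrow> j < 2 ^ Suc k \<longrightarrow>
    ereal_of_enat (complexity U x) \<le> ereal (real k + c * log 2 (real (max n 2)))"
proof -
  have "partial_recursive (\<lambda>e. rarely_hitting g (pfst (pfst e)) (psnd (pfst e)) (psnd e))"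
    by (intro partial_recursive_rarely_hitting[OF assms(2)] recursive_intros)
  from complexity_le_of_parameters[OF assms(1) this] show ?thesis
    by (metis fst_conv prod_encode_inverse snd_conv str_decode_code)
qed

theorem permutation_lower_bound:
  assumes "optimal_language U"
  shows "\<exists>c. \<forall>k n. 2 * k < n \<longrightarrow> (\<exists>x y. length x = n \<and> length y = n \<and>
    ereal_of_enat (complexity U x) \<le> ereal (real k + c * log 2 (real (max n 2))) \<and>
    ereal_of_enat (complexity U y) \<le> ereal (real k + c * log 2 (real (max n 2))) \<and>
    (\<forall>t. computes_permutation U t \<and> U t x = Some y \<longrightarrow>
      ereal (2 * real k) \<le> ereal_of_enat (complexity U t)))"
proof -
  obtain g where g: "approximates g (run_described U)"
    using assms partial_recursive_approximates[OF partial_recursive_run_described]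
    unfolding optimal_language_def by blast
  obtain cx where cx: "\<And>k n j x.
      rarely_hitting g k n j = Some (str_code x) \<Longrightarrow> k \<le> n \<Longrightarrow> j < 2 ^ Suc k \<Longrightarrow>
      ereal_of_enat (complexity U x) \<le> ereal (real k + cx * log 2 (real (max n 2)))"
    using complexity_rarely_hitting_le[OF assms g] by blast
  obtain cy where cy: "\<And>k n y. str_code y \<in> target_codes k n \<Longrightarrow> k \<le> n \<Longrightarrow>
      ereal_of_enat (complexity U y) \<le> ereal (real k + cy * log 2 (real (max n 2)))"
    using complexity_target_le[OF assms] by blast
  let ?bound = "\<lambda>c k n. ereal (real k + c * log 2 (real (max n 2)))"
  have bound_mono: "?bound c k n \<le> ?bound (max cx cy) k n" if "c \<le> max cx cy" for c k n
    using that by (simp add: mult_right_mono)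
  have "\<exists>x y. length x = n \<and> length y = n \<and>
      ereal_of_enat (complexity U x) \<le> ?bound (max cx cy) k n \<and>
      ereal_of_enat (complexity U y) \<le> ?bound (max cx cy) k n \<and>
      (\<forall>t. computes_permutation U t \<and> U t x = Some y \<longrightarrow>
        ereal (2 * real k) \<le> ereal_of_enat (complexity U t))"
    if kn: "2 * k < n" for k n
  proof -
    obtain x y j where "length x = n" "length y = n" and j: "j \<le> 2 ^ k"
      and x: "rarely_hitting g k n j = Some (str_code x)" and y: "str_code y \<in> target_codes k n"
      and perm: "\<And>t. computes_permutation U t \<Longrightarrow> U t x = Some y \<Longrightarrow> enat (2 * k) \<le> complexity U t"
      using ex_strings_missed_by_permutations[OF g kn] by blast
    moreover have "j < 2 ^ Suc k" using j by (rule le_less_trans) simp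
    with cx[OF x] kn have "ereal_of_enat (complexity U x) \<le> ?bound (max cx cy) k n"
      by (intro order_trans[OF _ bound_mono[of cx]]) simp_all
    moreover have "ereal_of_enat (complexity U y) \<le> ?bound (max cx cy) k n"
      using cy[OF y] kn by (intro order_trans[OF _ bound_mono[of cy]]) simp_all
    moreover have "ereal (2 * real k) \<le> ereal_of_enat (complexity U t)"
      if "computes_permutation U t" "U t x = Some y" for t
      using perm[OF that] ereal_of_enat_le_iff[of "enat (2 * k)"] by simp
    ultimately show ?thesis by blast
  qed
  then show ?thesis by blast
qed

theorem theorem3:
  fixes U :: language
  assumes "optimal_language U" and "goedel_language U"
  shows "(\<exists>c::real. \<forall>n\<ge>2. \<forall>x y :: bool list. length x \<le> n \<and> length y \<le> n \<longrightarrow>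
            (\<exists>t. computes_permutation U t \<and> U t x = Some y \<and>
              ereal_of_enat (complexity U t)
                \<le> ereal_of_enat (total_cond_complexity U x y)
                  + ereal_of_enat (total_cond_complexity U y x) + ereal (c * log 2 (real n))))
       \<and> (\<exists>c1 c2 :: real. \<forall>k n :: nat. n > 2 * k \<longrightarrow>
            (\<exists>x y :: bool list. length x = n \<and> length y = n \<and>
              ereal_of_enat (complexity U x) \<le> ereal (real k + c1 * log 2 (real (max n 2))) \<and>
              ereal_of_enat (complexity U y) \<le> ereal (real k + c1 * log 2 (real (max n 2))) \<and>
              (\<forall>t. computes_permutation U t \<and> U t x = Some y \<longrightarrow>
                 ereal (2 * real k - c2) \<le> ereal_of_enat (complexity U t))))"
  by (intro conjI permutation_upper_bound[OF assms])
     (use permutation_lower_bound[OF assms(1)] in \<open>metis diff_zero\<close>)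

end
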